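(* Let $d=2s$ be even, $\mathcal{A}\in\mathrm{S}^d(\mathbb{R}^2)$, $T=\begin{pmatrix}1&1\\0&1\end{pmatrix}$, and $y=(y_0,\dots,y_{2s})=\mathfrak{B}(\mathscr{L}_T(\mathcal{A}))$. Assume $H_1(y)\succeq0$, $H_2(y)\succeq0$ and $y_0>0$, and let $r=\operatorname{rank}H_1(y)$ (so $r\le s+1$). Define $$l=z^T M^{\dagger} z,\qquad u=y_{2s}-w^T N^{\dagger} w,$$ where $z=(y_{s+1},\dots,y_{2s})^T$, $M=(y_{i+j+1})_{0\le i,j\le s-1}$, $w=(y_s-y_{s+1},\,y_{s+1}-y_{s+2},\dots,y_{2s-1}-y_{2s})^T$, $N=(y_{i+j}-y_{i+j+1})_{0\le i,j\le s-1}$, and $^\dagger$ denotes the Moore–Penrose pseudoinverse. Then: (i) If $r\le s$, the linear system $\sum_{j=0}^{r-1}y_{i+j}g_j=y_{i+r}$ ($i=0,1,\dots,2s-r$) in unknowns $g_0,\dots,g_{r-1}$ has a unique solution. If $r=s+1$, then, setting $y_{2s+1}:=l$, the linear system $\sum_{j=0}^{s}y_{i+j}g_j=y_{i+s+1}$ ($i=0,1,\dots,s$) in unknowns $g_0,\dots,g_s$ has a unique solution. (ii) With $g_0,\dots,g_{r-1}$ the solution from (i), the polynomial $g(x)=g_0+g_1x+\cdots+g_{r-1}x^{r-1}-x^r$ has $r$ roots $x_1,\dots,x_r$ which are all distinct and belong to $[0,1]$, and there exists a unique $(\lambda_1,\dots,\lambda_r)$ with all $\lambda_i>0$ satisfying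 $y=\lambda_1[x_1]_d+\cdots+\lambda_r[x_r]_d$. Consequently $$\mathcal{A}=\begin{pmatrix}a_1\\ b_1\end{pmatrix}^{\otimes d}+\cdots+\begin{pmatrix}a_r\\ b_r\end{pmatrix}^{\otimes d},\quad a_i=\lambda_i^{1/d}(1-x_i)\ge0,\ b_i=\lambda_i^{1/d}x_i\ge0.$$ (iii) If $r\le s$, the representing measure for $y$ is unique. If $r=s+1$, the $r$-atomic representing measure for $y$ supported in $[0,1]$ is unique if and only if $l=u$. (iv) The cp-rank of $\mathcal{A}$ is $r$. If $r\le s$, the cp-rank decomposition of $\mathcal{A}$ is unique; if $r=s+1$, it is unique if and only if $l=u$.
   Context: $\mathrm{S}^d(\mathbb{R}^2)$ is the space of real symmetric tensors of order $d$ and dimension $2$; $v^{\otimes d}$ has entries $v_{i_1}\cdots v_{i_d}$. $\mathscr{L}_T$ is the linear map $(\mathscr{L}_T\mathcal{X})_{i_1\dots i_d}=\sum_{j_1,\dots,j_d}T_{i_1j_1}\cdots T_{i_dj_d}\mathcal{X}_{j_1\dots j_d}$. For $\mathcal{X}\in\mathrm{S}^d(\mathbb{R}^2)$, $\mathfrak{B}(\mathcal{X})=(x_0,\dots,x_d)$ with $x_k=\mathcal{X}_{i_1\dots i_d}$ whenever $i_1+\cdots+i_d-d=k$. $[t]_d:=(1,t,\dots,t^d)$. $X\succeq0$ means positive semidefinite. With indices from $0$: $H_1(y)=(y_{i+j})_{0\le i,j\le s}$ and $H_2(y)=(y_{i+j+1}-y_{i+j+2})_{0\le i,j\le s-1}$.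 A representing measure for $y=(y_0,\dots,y_d)$ is a Borel measure $\mu$ on $\mathbb{R}$ with $y_k=\int x^k\,d\mu$ for $k=0,\dots,d$; it is $r$-atomic if its support has exactly $r$ points. A cp-decomposition of $\mathcal{A}$ is an expression $\mathcal{A}=\sum_{i=1}^r v_i^{\otimes d}$ with $v_i\in\mathbb{R}^2_+$; the cp-rank is the smallest such $r$, and a cp-decomposition of that length is a cp-rank decomposition (uniqueness is up to reordering of summands). *)

theory Defs
  imports "HOL-Analysis.Analysis" "HOL-Computational_Algebra.Polynomial"
    "Jordan_Normal_Form.DL_Rank"
begin

text \<open>Indices are 0-based: an index tuple (i_1,...,i_d) with each i_k in {1,2} of the paper
  is represented as a list of length d with entries in {0,1}.  A tensor is a function
  on index lists that vanishes outside the valid index set.\<close>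

definition idx :: "nat \<Rightarrow> nat list set" where
  "idx d = {is. length is = d \<and> set is \<subseteq> {0,1}}"

type_synonym tensor = "nat list \<Rightarrow> real"

definition Sym :: "nat \<Rightarrow> tensor set" where
  "Sym d = {X. (\<forall>is. is \<notin> idx d \<longrightarrow> X is = 0) \<and>
               (\<forall>is\<in>idx d. \<forall>js\<in>idx d. mset is = mset js \<longrightarrow> X is = X js)}"

definition comp :: "real \<times> real \<Rightarrow> nat \<Rightarrow> real" where
  "comp v i = (if i = 0 then fst v else snd v)"

definition tpow :: "real \<times> real \<Rightarrow> nat \<Rightarrow> tensor" where
  "tpow v d = (\<lambda>is. if is \<in> idx d then (\<Prod>k<d. comp v (is ! k)) else 0)"

definition tsum :: "nat \<Rightarrow> (real \<times> real) list \<Rightarrow> tensor" where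
  "tsum d vs = (\<lambda>is. \<Sum>v\<leftarrow>vs. tpow v d is)"

definition LT :: "(nat \<Rightarrow> nat \<Rightarrow> real) \<Rightarrow> nat \<Rightarrow> tensor \<Rightarrow> tensor" where
  "LT T d X = (\<lambda>is. if is \<in> idx d then
       (\<Sum>js\<in>idx d. (\<Prod>k<d. T (is ! k) (js ! k)) * X js) else 0)"

definition Tup :: "nat \<Rightarrow> nat \<Rightarrow> real" where
  "Tup i j = (if i = 1 \<and> j = 0 then 0 else 1)"

definition Bvec :: "nat \<Rightarrow> tensor \<Rightarrow> nat \<Rightarrow> real" where
  "Bvec d X k = X (replicate (d - k) 0 @ replicate k 1)"

definition nonneg2 :: "real \<times> real \<Rightarrow> bool" where
  "nonneg2 v \<longleftrightarrow> fst v \<ge> 0 \<and> snd v \<ge> 0"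

definition cp_decomp :: "nat \<Rightarrow> tensor \<Rightarrow> (real \<times> real) list \<Rightarrow> bool" where
  "cp_decomp d A vs \<longleftrightarrow> (\<forall>v\<in>set vs. nonneg2 v) \<and> A = tsum d vs"

definition cp_rank :: "nat \<Rightarrow> tensor \<Rightarrow> nat" where
  "cp_rank d A = (LEAST r. \<exists>vs. length vs = r \<and> cp_decomp d A vs)"

definition unique_cp_rank_decomp :: "nat \<Rightarrow> tensor \<Rightarrow> bool" where
  "unique_cp_rank_decomp d A \<longleftrightarrow>
     (\<forall>vs ws. length vs = cp_rank d A \<and> cp_decomp d A vs \<and>
              length ws = cp_rank d A \<and> cp_decomp d A ws \<longrightarrow> mset vs = mset ws)"

definition psd :: "real mat \<Rightarrow> bool" where
  "psd A \<longleftrightarrow> A \<in> carrier_mat (dim_row A) (dim_row A) \<and> A\<^sup>T = A \<and>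
     (\<forall>x\<in>carrier_vec (dim_row A). scalar_prod x (A *\<^sub>v x) \<ge> 0)"

definition mrank :: "real mat \<Rightarrow> nat" where
  "mrank A = vec_space.rank (dim_row A) A"

definition pinv :: "real mat \<Rightarrow> real mat" where
  "pinv A = (THE X. X \<in> carrier_mat (dim_col A) (dim_row A) \<and>
       A * X * A = A \<and> X * A * X = X \<and> (A * X)\<^sup>T = A * X \<and> (X * A)\<^sup>T = X * A)"

definition H1 :: "nat \<Rightarrow> (nat \<Rightarrow> real) \<Rightarrow> real mat" where
  "H1 s y = mat (s+1) (s+1) (\<lambda>(i,j). y (i+j))"

definition H2 :: "nat \<Rightarrow> (nat \<Rightarrow> real) \<Rightarrow> real mat" where
  "H2 s y = mat s s (\<lambda>(i,j). y (i+j+1) - y (i+j+2))"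

definition rep_measure :: "nat \<Rightarrow> (nat \<Rightarrow> real) \<Rightarrow> real measure \<Rightarrow> bool" where
  "rep_measure d y \<mu> \<longleftrightarrow> sets \<mu> = sets borel \<and>
     (\<forall>k\<le>d. integrable \<mu> (\<lambda>x. x ^ k) \<and> (\<integral>x. x ^ k \<partial>\<mu>) = y k)"

definition msupport :: "real measure \<Rightarrow> real set" where
  "msupport \<mu> = {x. \<forall>U. open U \<and> x \<in> U \<longrightarrow> emeasure \<mu> U > 0}"

definition atomic :: "nat \<Rightarrow> real measure \<Rightarrow> bool" where
  "atomic r \<mu> \<longleftrightarrow> finite (msupport \<mu>) \<and> card (msupport \<mu>) = r"

end

theory Submission
  imports Defs "HOL-Computational_Algebra.Fundamental_Theorem_Algebra"
    "Jordan_Normal_Form.DL_Rank_Submatrix"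
begin

text \<open>Entrywise, the transform turns the summand with vector (a, b) into the moments of an atom of
  mass (a + b)^d at b / (a + b), so cp-decompositions are atomic representing measures on [0, 1].
  Let L be the linear functional on polynomials that sends x^k to y_k. If H_1 is singular, a kernel
  polynomial of least degree has distinct zeros in [0, 1] and Gauss quadrature represents y at these
  zeros; every representing measure then lives on them. If H_1 is nonsingular, apply the same
  argument to w q, where w is x or 1 - x and q is the monic orthogonal polynomial of degree s for the
  functional f \<mapsto> L (w f). For every representation on [0, 1], integrating w q^2 shows that the moment
  of order 2s + 1 lies between l and u, and the two endpoint measures attain these bounds.\<close>

section \<open>Moment functionals and Gauss quadrature\<close>

text \<open>An r-atomic measure has r nodes and r weights, hence 2r unknowns. For r <= s the 2s + 1
  given moments suffice; for r = s + 1 they are one short and the moment t of order 2s + 1 is a free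
  parameter. This is why the system of (i) then needs \<open>y(2 * s + 1 := l)\<close> and why
  uniqueness becomes l = u. The constants come from Schur complements: the integral of w q^2 is its
  top moment minus a quadratic form in M^-1 or N^-1, which is t - l for w = x and u - t for w = 1 -
  x.

  In the singular case the obstacle is exactness: a kernel polynomial of degree n is only known to
  be orthogonal up to degree s, so Gauss quadrature reaches order n + s. The remaining moments are
  forced one at a time by nonnegative test polynomials with leading coefficients of opposite signs.

  The lower bound for the cp-rank is a rank count: the Hankel matrix of a measure with at most s + 1
  atoms has rank equal to the number of atoms.\<close>

definition riesz :: "(nat \<Rightarrow> real) \<Rightarrow> real poly \<Rightarrow> real" where
  "riesz y p = (\<Sum>i\<le>degree p. coeff p i * y i)"

lemma riesz_altdef:
  assumes "degree p \<le> n"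
  shows "riesz y p = (\<Sum>i\<le>n. coeff p i * y i)"
  unfolding riesz_def
  by (rule sum.mono_neutral_left) (use assms in \<open>auto simp: coeff_eq_0\<close>)

lemma riesz_0 [simp]: "riesz y 0 = 0"
  by (simp add: riesz_def)

lemma riesz_add: "riesz y (p + q) = riesz y p + riesz y q"
proof -
  define n where "n = max (degree p) (degree q)"
  have "degree p \<le> n" "degree q \<le> n" "degree (p + q) \<le> n"
    by (auto simp: n_def degree_add_le)
  then show ?thesis
    by (simp add: riesz_altdef[of _ n] algebra_simps sum.distrib)
qed

lemma riesz_smult: "riesz y (Polynomial.smult a p) = a * riesz y p"
  using riesz_altdef[OF degree_smult_le, of y a p]
  by (simp add: riesz_def sum_distrib_left mult.assoc)

lemma riesz_minus: "riesz y (- p) = - riesz y p"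
  by (simp add: riesz_def sum_negf)

lemma riesz_diff: "riesz y (p - q) = riesz y p - riesz y q"
  using riesz_add[of y p "- q"] by (simp add: riesz_minus)

lemma riesz_sum: "riesz y (\<Sum>i\<in>I. f i) = (\<Sum>i\<in>I. riesz y (f i))"
  by (induction I rule: infinite_finite_induct) (auto simp: riesz_add)

lemma riesz_monom: "riesz y (monom a k) = a * y k"
  by (subst riesz_altdef[of _ k]) (auto simp: degree_monom_le if_distrib[of "\<lambda>x. x * _"] cong: if_cong)

lemma riesz_pCons: "riesz y (pCons a p) = a * y 0 + riesz (\<lambda>k. y (Suc k)) p"
proof -
  have "riesz y (pCons a p) = (\<Sum>i\<le>Suc (degree p). coeff (pCons a p) i * y i)"
    by (rule riesz_altdef) (simp add: degree_pCons_le)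
  also have "\<dots> = a * y 0 + riesz (\<lambda>k. y (Suc k)) p"
    unfolding sum.atMost_Suc_shift riesz_def by simp
  finally show ?thesis .
qed

lemma riesz_cong:
  assumes "degree p \<le> n" "\<And>k. k \<le> n \<Longrightarrow> y k = y' k"
  shows "riesz y p = riesz y' p"
  using assms by (simp add: riesz_def)

lemma riesz_mult:
  assumes "degree p \<le> a" "degree q \<le> b"
  shows "riesz y (p * q) = (\<Sum>i\<le>a. \<Sum>j\<le>b. coeff p i * coeff q j * y (i + j))"
proof -
  have "p * q = (\<Sum>i\<le>a. monom (coeff p i) i) * (\<Sum>j\<le>b. monom (coeff q j) j)"
    using assms by (simp add: poly_as_sum_of_monoms')
  also have "\<dots> = (\<Sum>i\<le>a. \<Sum>j\<le>b. monom (coeff p i * coeff q j) (i + j))"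
    by (simp add: sum_product mult_monom)
  finally show ?thesis
    by (simp add: riesz_sum riesz_monom)
qed

text \<open>Strict positivity of the weights makes X the exact support, so \<open>card X\<close>
  counts atoms.\<close>

definition atomic_rep :: "nat \<Rightarrow> (nat \<Rightarrow> real) \<Rightarrow> real set \<Rightarrow> (real \<Rightarrow> real) \<Rightarrow> bool" where
  "atomic_rep D y X c \<longleftrightarrow>
     finite X \<and> (\<forall>x\<in>X. c x > 0) \<and> (\<forall>k\<le>D. y k = (\<Sum>x\<in>X. c x * x ^ k))"

lemma riesz_quadrature:
  assumes "\<And>k. k \<le> D \<Longrightarrow> y k = (\<Sum>x\<in>X. c x * x ^ k)" "degree p \<le> D"
  shows "riesz y p = (\<Sum>x\<in>X. c x * poly p x)"
proof -
  have "riesz y p = (\<Sum>i\<le>degree p. \<Sum>x\<in>X. coeff p i * (c x * x ^ i))"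
    using assms by (simp add: riesz_def sum_distrib_left)
  also have "\<dots> = (\<Sum>x\<in>X. c x * poly p x)"
    by (subst sum.swap) (simp add: poly_altdef sum_distrib_left mult_ac)
  finally show ?thesis .
qed

lemma riesz_atomic_rep:
  assumes "atomic_rep D y X c" "degree p \<le> D"
  shows "riesz y p = (\<Sum>x\<in>X. c x * poly p x)"
  using assms by (intro riesz_quadrature[of D]) (auto simp: atomic_rep_def)

text \<open>The irreducible factors of a real polynomial have degree at most two, so the only
  obstruction to splitting into distinct linear factors is a factor (x - a)^2 + b^2, where b = 0
  accounts for multiple roots.\<close>

lemma distinct_real_roots_or_quadratic_factor:
  fixes p :: "real poly"
  assumes "p \<noteq> 0"
  shows "card {x. poly p x = 0} = degree p \<or> (\<exists>a b h. p = ([:-a, 1:]\<^sup>2 + [:b\<^sup>2:]) * h)"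
  using assms
proof (induction "degree p" arbitrary: p)
  case 0
  then obtain c where "p = [:c:]" "c \<noteq> 0"
    by (metis degree_eq_zeroE pCons_eq_0_iff)
  then show ?case by simp
next
  case (Suc n)
  define P where "P = map_poly complex_of_real p"
  have deg: "degree P = degree p"
    unfolding P_def by (rule degree_map_poly) simp
  have "\<not> constant (poly P)"
    using Suc.hyps(2) deg constant_degree[of P] by simp
  then obtain z where z: "poly P z = 0"
    using fundamental_theorem_of_algebra by blast
  show ?case
  proof (cases "Im z = 0")
    case False
    \<comment> \<open>The real quadratic with zeros z and its conjugate. The remainder of p modulo Q
      is real, of degree at most one and zero at the nonreal point z, hence zero.\<close>
    define Q where "Q = ([:- Re z, 1:]\<^sup>2 + [:(Im z)\<^sup>2:] :: real poly)"
    have Qeq: "Q = [:(Re z)\<^sup>2 + (Im z)\<^sup>2, - 2 * Re z, 1:]"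
      by (simp add: Q_def power2_eq_square)
    then have Q0: "Q \<noteq> 0" and degQ: "degree Q = 2" by auto
    have degR: "degree (p mod Q) \<le> 1"
      using degree_mod_less[OF Q0, of p] degQ by auto
    then obtain e f where R: "p mod Q = [:e, f:]"
      by (metis One_nat_def degree_pCons_le le_antisym degree1_coeffs degree_eq_zeroE less_one linorder_not_le pCons_0_0 le_SucE)
    have "map_poly complex_of_real (f * Q + g) = map_poly of_real f * map_poly of_real Q + map_poly of_real g" for f g
      by (rule poly_eqI) (simp add: coeff_map_poly coeff_mult)
    from this[of "p div Q" "p mod Q"] have "poly P z = poly (map_poly of_real (p div Q)) z * poly (map_poly of_real Q) z
        + poly (map_poly of_real (p mod Q)) z"
      by (simp add: P_def)
    moreover have "poly (map_poly of_real Q) z = 0"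
      unfolding Qeq by (auto simp: map_poly_pCons complex_eq_iff power2_eq_square algebra_simps)
    ultimately have "of_real e + z * of_real f = 0"
      using z R by (simp add: map_poly_pCons)
    then have "f = 0" "e = 0"
      using False by (auto simp: complex_eq_iff)
    then have "p = Q * (p div Q)"
      using R by (metis div_mult_mod_eq add.right_neutral pCons_0_0 mult.commute)
    then show ?thesis unfolding Q_def by blast
  next
    case True
    define x where "x = Re z"
    have "z = of_real x" using True by (simp add: x_def complex_eq_iff)
    moreover have "poly (map_poly of_real f) (of_real x) = complex_of_real (poly f x)" for f
      by (induction f) (auto simp: map_poly_pCons)
    ultimately have "of_real (poly p x) = (0::complex)"
      using z by (metis P_def)
    then have "poly p x = 0" by (simp only: of_real_eq_0_iff)
    then obtain q where q: "p = [:-x, 1:] * q"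
      by (auto simp: poly_eq_0_iff_dvd elim: dvdE)
    have q0: "q \<noteq> 0" using Suc.prems q by auto
    have degq: "degree q = n"
      using q0 Suc.hyps(2) degree_mult_eq[of "[:-x, 1:]" q] unfolding q by simp
    show ?thesis
    proof (cases "poly q x = 0")
      case True
      then obtain h where "q = [:-x, 1:] * h"
        by (auto simp: poly_eq_0_iff_dvd elim: dvdE)
      then have "p = ([:-x, 1:]\<^sup>2 + [:0\<^sup>2:]) * h"
        using q by (simp only: power2_eq_square mult_zero_left pCons_0_0 add_0_right mult.assoc)
      then show ?thesis by blast
    next
      case False
      from Suc.hyps(1)[OF degq[symmetric] q0] show ?thesis
      proof
        assume card: "card {x. poly q x = 0} = degree q"
        have "{x. poly p x = 0} = insert x {x. poly q x = 0}"
          using q by auto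
        then have "card {x. poly p x = 0} = Suc (degree q)"
          using False card poly_roots_finite[OF q0] by simp
        then show ?thesis using degq Suc.hyps(2) by simp
      next
        assume "\<exists>a b h. q = ([:-a, 1:]\<^sup>2 + [:b\<^sup>2:]) * h"
        then obtain a b h where "q = ([:-a, 1:]\<^sup>2 + [:b\<^sup>2:]) * h" by blast
        then have "p = ([:-a, 1:]\<^sup>2 + [:b\<^sup>2:]) * ([:-x, 1:] * h)"
          using q by (simp only: mult_ac)
        then show ?thesis by blast
      qed
    qed
  qed
qed

text \<open>A factor (x - a)^2 + b^2 of p with cofactor h would make F(p h) a sum of squares with a positive term.\<close>

lemma orthogonal_poly_distinct_roots:
  fixes p :: "real poly" and F :: "real poly \<Rightarrow> real"
  assumes add: "\<And>f g. F (f + g) = F f + F g"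
    and smult: "\<And>a f. F (Polynomial.smult a f) = a * F f"
    and p0: "p \<noteq> 0"
    and orth: "\<And>h. degree h < degree p \<Longrightarrow> F (p * h) = 0"
    and pos: "\<And>h. h \<noteq> 0 \<Longrightarrow> degree h < degree p \<Longrightarrow> F (h * h) > 0"
  shows "card {x. poly p x = 0} = degree p"
proof (rule ccontr)
  assume "card {x. poly p x = 0} \<noteq> degree p"
  then obtain a b h where p: "p = ([:-a, 1:]\<^sup>2 + [:b\<^sup>2:]) * h"
    using distinct_real_roots_or_quadratic_factor[OF p0] by blast
  define k where "k = [:-a, 1:] * h"
  have h0: "h \<noteq> 0" using p p0 by auto
  have k0: "k \<noteq> 0" using h0 unfolding k_def by (simp only: mult_eq_0_iff) simp
  have "degree ([:-a, 1:]\<^sup>2 + [:b\<^sup>2:]) = 2"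
    by (simp add: power2_eq_square)
  then have degp: "degree p = 2 + degree h"
    using h0 p p0 by (metis degree_mult_eq mult_eq_0_iff)
  have degk: "degree k = Suc (degree h)"
    using h0 unfolding k_def by (subst degree_mult_eq) simp_all
  have "(u\<^sup>2 + v) * h * h = u * h * (u * h) + v * (h * h)" for u v :: "real poly"
    by (simp add: power2_eq_square algebra_simps)
  from this[of "[:-a, 1:]" "[:b\<^sup>2:]"] have "p * h = k * k + Polynomial.smult (b\<^sup>2) (h * h)"
    by (simp only: p k_def) simp
  then have "F (p * h) = F (k * k) + b\<^sup>2 * F (h * h)"
    by (simp add: add smult)
  moreover have "F (k * k) > 0" "F (h * h) > 0"
    using pos k0 h0 degk degp by auto
  moreover have "F (p * h) = 0"
    using orth degp by simp
  ultimately show False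
    by (smt (verit) mult_nonneg_nonneg zero_le_power2)
qed

section \<open>Lagrange interpolation and Gauss quadrature\<close>

definition node_poly :: "real set \<Rightarrow> real poly" where
  "node_poly X = (\<Prod>a\<in>X. [:-a, 1:])"

lemma degree_node_poly: "degree (node_poly X) = card X"
  by (simp add: node_poly_def degree_prod_sum_eq)

lemma poly_node_poly_eq_0_iff: "finite X \<Longrightarrow> poly (node_poly X) x = 0 \<longleftrightarrow> x \<in> X"
  by (auto simp: node_poly_def poly_prod)

lemma lead_coeff_node_poly: "lead_coeff (node_poly X) = 1"
  by (simp add: node_poly_def lead_coeff_prod)

definition lagrange :: "real set \<Rightarrow> real \<Rightarrow> real poly" where
  "lagrange X a = Polynomial.smult (inverse (poly (node_poly (X - {a})) a)) (node_poly (X - {a}))"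

lemma degree_lagrange:
  assumes "finite X" "a \<in> X"
  shows "degree (lagrange X a) = card X - 1"
  using assms poly_node_poly_eq_0_iff[of "X - {a}" a]
  by (simp add: lagrange_def degree_node_poly)

lemma poly_lagrange:
  assumes "finite X" "a \<in> X" "x \<in> X"
  shows "poly (lagrange X a) x = (if x = a then 1 else 0)"
  using assms poly_node_poly_eq_0_iff[of "X - {a}"]
  by (auto simp: lagrange_def)

lemma sum_lagrange:
  assumes "finite X" "x \<in> X"
  shows "(\<Sum>a\<in>X. f a * poly (lagrange X x) a) = f x"
  using assms by (simp add: poly_lagrange if_distrib[of "\<lambda>t. _ * t"] cong: if_cong)

text \<open>Divide by p and interpolate the remainder at the zeros of p.\<close>

lemma gauss_quadrature:
  assumes p0: "p \<noteq> 0" and card: "card {x. poly p x = 0} = degree p"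
    and orth: "\<And>h. degree h \<le> m \<Longrightarrow> riesz y (p * h) = 0"
    and pos: "\<And>h. h \<noteq> 0 \<Longrightarrow> degree h < degree p \<Longrightarrow> riesz y (h * h) > 0"
    and m: "degree p \<le> m + 2" and p1: "degree p > 0"
  shows "\<exists>c. atomic_rep (degree p + m) y {x. poly p x = 0} c"
proof -
  define X where "X = {x. poly p x = 0}"
  have fin: "finite X" unfolding X_def using p0 by (rule poly_roots_finite)
  have cX: "card X = degree p" using card by (simp add: X_def)
  \<comment> \<open>The weights are forced: a rule exact on the Lagrange polynomials must reproduce
    L on them.\<close>
  define c where "c x = riesz y (lagrange X x)" for x
  have quad: "riesz y f = (\<Sum>x\<in>X. c x * poly f x)" if f: "degree f \<le> degree p + m" for f
  proof -
    have mod_lt: "degree (f mod p) < card X"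
      using degree_mod_less[OF p0, of f] cX p1 by auto
    have "f mod p = (\<Sum>x\<in>X. Polynomial.smult (poly f x) (lagrange X x))"
    proof (rule poly_eqI_degree[of X])
      fix x assume x: "x \<in> X"
      have "poly f x = poly (f div p * p + f mod p) x" by simp
      also have "\<dots> = poly (f mod p) x"
        using x by (simp only: poly_add poly_mult) (simp add: X_def)
      finally have 1: "poly (f mod p) x = poly f x" by simp
      have "poly (\<Sum>x\<in>X. Polynomial.smult (poly f x) (lagrange X x)) x
          = (\<Sum>a\<in>X. poly f a * (if x = a then 1 else 0))"
        using x fin by (simp add: poly_sum poly_lagrange)
      also have "\<dots> = poly f x"
        using x fin by (simp add: if_distrib[of "\<lambda>t. _ * t"] cong: if_cong)
      finally show "poly (f mod p) x = poly (\<Sum>x\<in>X. Polynomial.smult (poly f x) (lagrange X x)) x"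
        using 1 by simp
    next
      show "degree (f mod p) < card X" by (rule mod_lt)
      have "degree (\<Sum>x\<in>X. Polynomial.smult (poly f x) (lagrange X x)) \<le> card X - 1"
        using fin by (intro degree_sum_le) (auto intro: order_trans[OF degree_smult_le] simp: degree_lagrange)
      then show "degree (\<Sum>x\<in>X. Polynomial.smult (poly f x) (lagrange X x)) < card X"
        using cX p1 by linarith
    qed
    moreover have "degree (f div p) \<le> m"
    proof (cases "f div p = 0")
      case False
      have "degree (f div p * p) = degree (f div p) + degree p"
        using False p0 by (simp add: degree_mult_eq)
      moreover have "f div p * p = f - f mod p"
        by (simp add: minus_mod_eq_div_mult)
      moreover have "degree (f - f mod p) \<le> degree p + m"
        using f mod_lt cX by (intro degree_diff_le) auto
      ultimately show ?thesis by simp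
    qed simp
    then have "riesz y (p * (f div p)) = 0" by (rule orth)
    moreover have "riesz y f = riesz y (p * (f div p)) + riesz y (f mod p)"
      by (metis riesz_add mult_div_mod_eq)
    ultimately show ?thesis
      by (simp add: riesz_sum riesz_smult c_def mult.commute)
  qed
  \<comment> \<open>Apply the rule to the squared Lagrange polynomial, which is 1 at x and 0 at the
    other nodes. Its degree 2 (deg p - 1) is within reach because of
    \<open>degree p \<le> m + 2\<close>.\<close>
  have "c x > 0" if x: "x \<in> X" for x
  proof -
    have deg: "degree (lagrange X x) = degree p - 1"
      using fin x cX by (simp add: degree_lagrange)
    have "lagrange X x \<noteq> 0"
      using poly_lagrange[OF fin x x] by auto
    then have "0 < riesz y (lagrange X x * lagrange X x)"
      using pos deg p1 by simp
    also have "\<dots> = (\<Sum>a\<in>X. c a * poly (lagrange X x * lagrange X x) a)"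
    proof (rule quad)
      have "degree (lagrange X x * lagrange X x) \<le> (degree p - 1) + (degree p - 1)"
        using degree_mult_le[of "lagrange X x" "lagrange X x"] deg by simp
      then show "degree (lagrange X x * lagrange X x) \<le> degree p + m"
        using m by linarith
    qed
    also have "\<dots> = (\<Sum>a\<in>X. (c a * poly (lagrange X x) a) * poly (lagrange X x) a)"
      by (simp add: mult.assoc)
    also have "\<dots> = c x * poly (lagrange X x) x"
      by (rule sum_lagrange[OF fin x])
    also have "\<dots> = c x"
      using x fin by (simp add: poly_lagrange)
    finally show ?thesis .
  qed
  moreover have "y k = (\<Sum>x\<in>X. c x * x ^ k)" if "k \<le> degree p + m" for k
    using quad[of "monom 1 k"] that by (simp add: riesz_monom poly_monom degree_monom_eq)
  ultimately have "atomic_rep (degree p + m) y X c"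
    using fin by (simp add: atomic_rep_def)
  then show ?thesis unfolding X_def by blast
qed

section \<open>Hankel matrices\<close>

text \<open>The theorem consults l and u only for r = s + 1, where M and N are positive definite, so
  the definite description in \<open>pinv\<close> is resolved for invertible matrices. There A X A =
  A alone already gives X = A^-1.\<close>

lemma pinv_nonsingular:
  assumes A: "A \<in> carrier_mat n n" and det: "det A \<noteq> 0"
  shows "pinv A \<in> carrier_mat n n" "A * pinv A = 1\<^sub>m n"
proof -
  obtain B where B: "B \<in> carrier_mat n n" and AB: "A * B = 1\<^sub>m n" and BA: "B * A = 1\<^sub>m n"
    using det_non_zero_imp_unit[OF A det, of "()"] by (auto simp: Units_def ring_mat_def)
  have "pinv A = B"
    unfolding pinv_def
  proof (rule the_equality)
    show "B \<in> carrier_mat (dim_col A) (dim_row A) \<and> A * B * A = A \<and> B * A * B = B \<and>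
        (A * B)\<^sup>T = A * B \<and> (B * A)\<^sup>T = B * A"
      using A B AB BA by auto
  next
    fix X assume X: "X \<in> carrier_mat (dim_col A) (dim_row A) \<and> A * X * A = A \<and> X * A * X = X \<and>
        (A * X)\<^sup>T = A * X \<and> (X * A)\<^sup>T = X * A"
    then have Xc: "X \<in> carrier_mat n n" using A by auto
    have "X = B * A * X * (A * B)"
      using AB BA Xc by simp
    also have "\<dots> = B * (A * X * A) * B"
      using A B Xc by (simp add: assoc_mult_mat[where n\<^sub>1=n and n\<^sub>2=n and n\<^sub>3=n and n\<^sub>4=n])
    also have "\<dots> = B"
      using X BA B by simp
    finally show "X = B" .
  qed
  then show "pinv A \<in> carrier_mat n n" "A * pinv A = 1\<^sub>m n"
    using B AB by auto
qed

lemma degree_sum_monom_less: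
  assumes "n > 0"
  shows "degree (\<Sum>j<n. monom (f j) j) < n"
proof -
  have "degree (\<Sum>j<n. monom (f j) j) \<le> n - 1"
    by (intro degree_sum_le) (auto intro: order_trans[OF degree_monom_le])
  then show ?thesis using assms by linarith
qed

lemma coeff_sum_monom: "coeff (\<Sum>j<n. monom (f j) j) i = (if i < n then f i else 0)"
  by (auto simp: coeff_sum if_distrib[of "\<lambda>t. _ * t"] cong: if_cong)

lemma poly_as_sum_of_monoms_less:
  assumes "degree p < n"
  shows "(\<Sum>j<n. monom (coeff p j) j) = p"
  by (rule poly_eqI) (use assms in \<open>auto simp: coeff_sum_monom coeff_eq_0\<close>)

lemma riesz_mult_less:
  assumes "degree p < n" "degree q < n"
  shows "riesz y (p * q) = (\<Sum>i<n. coeff p i * (\<Sum>j<n. y (i + j) * coeff q j))"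
proof -
  obtain k where "n = Suc k" using assms by (cases n) auto
  then show ?thesis
    using assms by (simp add: riesz_mult[of p k q k] lessThan_Suc_atMost sum_distrib_left mult_ac)
qed

lemma scalar_prod_hankel:
  fixes m :: "nat \<Rightarrow> real"
  assumes "x \<in> carrier_vec n"
  shows "scalar_prod x (mat n n (\<lambda>(i,j). m (i + j)) *\<^sub>v x)
    = (\<Sum>i<n. x $ i * (\<Sum>j<n. m (i + j) * x $ j))"
  using assms by (auto simp: scalar_prod_def atLeast0LessThan)

lemma riesz_square_nonneg_if_psd:
  assumes "psd (mat n n (\<lambda>(i,j). m (i + j)))" "degree h < n"
  shows "riesz m (h * h) \<ge> 0"
proof -
  have "scalar_prod (vec n (coeff h)) (mat n n (\<lambda>(i,j). m (i + j)) *\<^sub>v vec n (coeff h)) \<ge> 0"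
    using assms(1) by (simp add: psd_def)
  then show ?thesis
    using assms(2) by (subst (asm) scalar_prod_hankel) (simp_all add: riesz_mult_less[of h n])
qed

text \<open>A kernel vector, read as a coefficient list, would be a nonzero polynomial whose square
  has value 0.\<close>

lemma det_hankel_neq_0:
  assumes pos: "\<And>h. h \<noteq> 0 \<Longrightarrow> degree h < n \<Longrightarrow> riesz m (h * h) > 0"
  shows "det (mat n n (\<lambda>(i,j). m (i + j))) \<noteq> 0"
proof
  let ?M = "mat n n (\<lambda>(i,j). m (i + j))"
  assume "det ?M = 0"
  then obtain v where v: "v \<in> carrier_vec n" "v \<noteq> 0\<^sub>v n" "?M *\<^sub>v v = 0\<^sub>v n"
    using det_0_iff_vec_prod_zero_field[of ?M n] by auto
  obtain i where i: "i < n" "v $ i \<noteq> 0"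
    using v(1,2) by (metis carrier_vecD eq_vecI index_zero_vec)
  define h where "h = (\<Sum>j<n. monom (v $ j) j)"
  have coeff_h: "coeff h j = v $ j" if "j < n" for j
    using that by (simp add: h_def coeff_sum_monom)
  then have "coeff h i \<noteq> 0" using i by simp
  then have "h \<noteq> 0" by auto
  moreover have deg: "degree h < n"
    unfolding h_def using i by (intro degree_sum_monom_less) simp
  ultimately have "riesz m (h * h) > 0" by (rule pos)
  also have "riesz m (h * h) = scalar_prod v (?M *\<^sub>v v)"
    using v(1) by (simp only: scalar_prod_hankel) (simp add: riesz_mult_less[OF deg deg] coeff_h)
  also have "\<dots> = 0" using v by simp
  finally show False by simp
qed

text \<open>The vector v = M^-1 z solves the normal equations, so q = x^n - sum v_j x^j is the monic
  orthogonal polynomial, and the value at q^2 is the Schur complement of M in the Hankel matrix of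
  order n + 1. The sequence \<open>m'\<close> leaves the moment of order 2n free: it enters only
  that value, and it may differ between representing measures.\<close>

lemma orthogonal_poly_pinv:
  fixes m :: "nat \<Rightarrow> real"
  assumes pos: "\<And>h. h \<noteq> 0 \<Longrightarrow> degree h < n \<Longrightarrow> riesz m (h * h) > 0" and n: "n > 0"
    and M: "M = mat n n (\<lambda>(i,j). m (i + j))" and z: "z = vec n (\<lambda>i. m (n + i))"
  obtains q where "degree q = n"
    "\<And>m' h. (\<And>k. k < 2 * n \<Longrightarrow> m' k = m k) \<Longrightarrow> degree h < n \<Longrightarrow> riesz m' (q * h) = 0"
    "\<And>m'. (\<And>k. k < 2 * n \<Longrightarrow> m' k = m k) \<Longrightarrow>
      riesz m' (q * q) = m' (2 * n) - scalar_prod z (pinv M *\<^sub>v z)"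
proof -
  define v where "v = pinv M *\<^sub>v z"
  have Mc: "M \<in> carrier_mat n n" by (simp add: M)
  have zc: "z \<in> carrier_vec n" by (simp add: z)
  have det: "det M \<noteq> 0" unfolding M by (rule det_hankel_neq_0[OF pos])
  note P = pinv_nonsingular[OF Mc det]
  have vc: "v \<in> carrier_vec n" using P(1) zc by (simp add: v_def)
  have Mvz: "M *\<^sub>v v = z"
    using assoc_mult_mat_vec[OF Mc P(1) zc] P(2) zc by (simp add: v_def)
  have Mv: "(\<Sum>j<n. m (i + j) * v $ j) = m (n + i)" if "i < n" for i
  proof -
    have "(M *\<^sub>v v) $ i = z $ i" by (simp only: Mvz)
    then show ?thesis using that vc by (simp add: M z scalar_prod_def atLeast0LessThan)
  qed
  define a where "a = (\<Sum>j<n. monom (v $ j) j)"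
  define q where "q = monom 1 n - a"
  have dega: "degree a < n" unfolding a_def by (rule degree_sum_monom_less[OF n])
  have degq: "degree q = n"
  proof -
    have "degree (monom (1::real) n) = n" by (simp add: degree_monom_eq)
    then show ?thesis
      using degree_add_eq_left[of "- a" "monom 1 n"] dega by (simp add: q_def)
  qed
  have qm: "riesz m' (q * monom 1 i) = m' (n + i) - (\<Sum>j<n. m' (i + j) * v $ j)" for m' i
  proof -
    have "riesz m' (q * monom 1 i) = m' (n + i) - (\<Sum>j<n. v $ j * m' (j + i))"
      by (simp add: q_def a_def left_diff_distrib sum_distrib_right mult_monom riesz_diff riesz_sum
          riesz_monom)
    then show ?thesis by (simp add: add.commute mult.commute)
  qed
  have orth: "riesz m' (q * h) = 0"
    if m': "\<And>k. k < 2 * n \<Longrightarrow> m' k = m k" and h: "degree h < n" for m' h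
  proof -
    have "q * h = (\<Sum>i<n. Polynomial.smult (coeff h i) (q * monom 1 i))"
      by (subst poly_as_sum_of_monoms_less[OF h, symmetric])
        (simp add: sum_distrib_left mult_smult_right[symmetric] smult_monom del: mult_smult_right)
    then show ?thesis
      by (simp add: riesz_sum riesz_smult qm Mv m')
  qed
  have "riesz m' (q * q) = m' (2 * n) - scalar_prod z v"
    if m': "\<And>k. k < 2 * n \<Longrightarrow> m' k = m k" for m'
  proof -
    have "q * q = q * monom 1 n - q * a"
      by (simp add: q_def algebra_simps)
    then have "riesz m' (q * q) = m' (n + n) - (\<Sum>j<n. m' (n + j) * v $ j)"
      by (simp add: riesz_diff qm orth[OF m' dega])
    then show ?thesis
      using vc by (simp add: m' z scalar_prod_def atLeast0LessThan mult_2)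
  qed
  then show ?thesis
    using that degq orth unfolding v_def by blast
qed

text \<open>A nonzero polynomial of degree below the number of nodes cannot vanish at all of
  them.\<close>

lemma riesz_square_pos_of_atomic_rep:
  assumes rep: "atomic_rep D y X c" and h: "h \<noteq> 0" "degree h < card X" "2 * degree h \<le> D"
  shows "riesz y (h * h) > 0"
proof -
  have fin: "finite X" and pos: "\<And>x. x \<in> X \<Longrightarrow> c x > 0"
    using rep by (auto simp: atomic_rep_def)
  have "\<exists>x\<in>X. poly h x \<noteq> 0"
    using poly_eqI_degree[of X h 0] h by fastforce
  then obtain x where x: "x \<in> X" "poly h x \<noteq> 0" by blast
  have "0 < (\<Sum>x\<in>X. c x * (poly h x * poly h x))"
    using fin pos x by (intro sum_pos2[of X x]) (auto simp: less_imp_le zero_less_mult_iff linorder_neq_iff)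
  also have "\<dots> = riesz y (h * h)"
    using h degree_mult_le[of h h] by (subst riesz_atomic_rep[OF rep]) auto
  finally show ?thesis .
qed

text \<open>The matrix is a sum of one rank-one matrix per node, which bounds the rank from above;
  its leading minor of order \<open>card X\<close> belongs to a positive definite form, which bounds
  it from below. Hence all representations with at most s + 1 atoms have equally many.\<close>

lemma mrank_atomic_hankel:
  assumes rep: "atomic_rep (2 * s) y X c" and card: "card X \<le> s + 1"
  shows "mrank (H1 s y) = card X"
proof (rule antisym)
  define n where "n = s + 1"
  interpret vec_space "TYPE(real)" n .
  define A where "A = (\<lambda>Y. mat n n (\<lambda>(i,j). \<Sum>x\<in>Y. c x * x ^ (i + j)))"
  have fin: "finite X" using rep by (simp add: atomic_rep_def)
  have H1A: "H1 s y = A X"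
    using rep by (auto simp: H1_def A_def n_def atomic_rep_def intro!: eq_matI)
  have mr: "mrank (H1 s y) = rank (A X)"
    by (simp add: mrank_def H1A) (simp add: A_def)
  have "rank (A Y) \<le> card Y" if "finite Y" for Y
    using that
  proof (induction Y rule: finite_induct)
    case empty
    have "A {} = 0\<^sub>m n n" by (auto simp: A_def)
    then show ?case by (simp add: rank_0I)
  next
    case (insert x Y)
    have "A (insert x Y) = A Y + A {x}"
      using insert by (auto simp: A_def intro!: eq_matI)
    moreover have "rank (A {x}) \<le> 1"
      by (rule rank_le_1_product_entries[of _ n "\<lambda>i. c x * x ^ i" "\<lambda>j. x ^ j"])
        (auto simp: A_def power_add)
    moreover have "rank (A Y + A {x}) \<le> rank (A Y) + rank (A {x})"
      by (rule rank_subadditive[of _ n]) (auto simp: A_def)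
    ultimately show ?case using insert by simp
  qed
  then show "mrank (H1 s y) \<le> card X" using fin mr by simp
  define k where "k = card X"
  have sub: "submatrix (H1 s y) {..<k} {..<k} = mat k k (\<lambda>(i,j). y (i + j))"
  proof -
    have "{i. i < s + 1 \<and> i < k} = {..<k}" using card by (auto simp: k_def)
    moreover have "pick {..<k} i = i" if "i < k" for i
    proof -
      have "{a \<in> {..<k}. a < i} = {..<i}" using that by auto
      then show ?thesis using pick_card_in_set[of i "{..<k}"] that by simp
    qed
    ultimately show ?thesis
      using card by (auto simp: submatrix_def H1_def k_def intro!: eq_matI)
  qed
  have "riesz y (h * h) > 0" if "h \<noteq> 0" "degree h < k" for h
    by (rule riesz_square_pos_of_atomic_rep[OF rep]) (use that card in \<open>auto simp: k_def\<close>)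
  then have "det (submatrix (H1 s y) {..<k} {..<k}) \<noteq> 0"
    unfolding sub by (rule det_hankel_neq_0)
  moreover have "H1 s y \<in> carrier_mat n n" by (simp add: H1_def n_def)
  ultimately have "card {j. j < n \<and> j \<in> {..<k}} \<le> rank (H1 s y)"
    by (intro rank_gt_minor)
  moreover have "{j. j < n \<and> j \<in> {..<k}} = {..<k}"
    using card by (auto simp: k_def n_def)
  ultimately show "card X \<le> mrank (H1 s y)"
    unfolding mr by (simp only: H1A card_lessThan k_def)
qed

section \<open>Truncated Hausdorff moment sequences\<close>

text \<open>The sequence L(w x^k) belongs to the functional f \<mapsto> L(w f), so the Hankel lemmas
  also serve weighted functionals.\<close>

lemma riesz_weight: "riesz (\<lambda>k. riesz y (w * monom 1 k)) f = riesz y (w * f)"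
proof -
  have "w * f = (\<Sum>i\<le>degree f. Polynomial.smult (coeff f i) (w * monom 1 i))"
    by (subst poly_as_sum_of_monoms[of f, symmetric])
      (simp add: sum_distrib_left mult_smult_right[symmetric] smult_monom del: mult_smult_right)
  then have "riesz y (w * f) = (\<Sum>i\<le>degree f. coeff f i * riesz y (w * monom 1 i))"
    by (simp add: riesz_sum riesz_smult)
  then show ?thesis
    by (simp add: riesz_def[of "\<lambda>k. riesz y (w * monom 1 k)"])
qed

text \<open>The weights x and 1 - x of the two endpoints satisfy w (1 - w) = x (1 - x).\<close>

definition end_weight :: "real poly \<Rightarrow> bool" where
  "end_weight w \<longleftrightarrow> w = [:0, 1:] \<or> w = [:1, -1:]"

lemma end_weight_square: "end_weight w \<Longrightarrow> w * f = w * w * f + [:0, 1, -1:] * f"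
proof -
  assume "end_weight w"
  then have "w = w * w + [:0, 1, -1:]" by (auto simp: end_weight_def)
  then show ?thesis by (metis distrib_right)
qed

lemma degree_end_weight: "end_weight w \<Longrightarrow> degree w = 1"
  by (auto simp: end_weight_def)

lemma end_weight_neq_0: "end_weight w \<Longrightarrow> w \<noteq> 0"
  by (auto simp: end_weight_def)

lemma poly_end_weight_nonneg: "end_weight w \<Longrightarrow> x \<in> {0..1} \<Longrightarrow> poly w x \<ge> 0"
  by (auto simp: end_weight_def)

lemma poly_end_weight_in_unit: "end_weight w \<Longrightarrow> poly w x \<in> {0..1} \<longleftrightarrow> x \<in> {0..1}"
  by (auto simp: end_weight_def)

text \<open>Positive semidefiniteness of H_1 and H_2 read through coefficient vectors: H_2 is the
  Hankel matrix of the sequence L(x(1 - x) x^k).\<close>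

locale truncated_hausdorff =
  fixes s :: nat and y :: "nat \<Rightarrow> real"
  assumes square_nonneg: "\<And>h. degree h \<le> s \<Longrightarrow> riesz y (h * h) \<ge> 0"
    and weighted_square_nonneg: "\<And>h. degree h < s \<Longrightarrow> riesz y ([:0, 1, -1:] * (h * h)) \<ge> 0"
    and mass_pos: "y 0 > 0"
begin

lemma degree_end_weight_mult_le: "end_weight w \<Longrightarrow> degree h < s \<Longrightarrow> degree (w * h) \<le> s"
  using degree_mult_le[of w h] degree_end_weight[of w] by linarith

text \<open>From w = w^2 + x(1 - x): the form with an endpoint weight is the H_1 form at w h plus
  the H_2 form at h. For deg h < s both arguments are in range, so H_1 and H_2 together control both
  endpoint weights.\<close>

lemma riesz_end_weight:
  assumes "end_weight w"
  shows "riesz y (w * (h * h)) = riesz y (w * h * (w * h)) + riesz y ([:0, 1, -1:] * (h * h))"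
  using end_weight_square[OF assms, of "h * h"] by (simp only: riesz_add[symmetric] mult_ac)

lemma end_weight_nonneg:
  assumes "end_weight w" "degree h < s"
  shows "riesz y (w * (h * h)) \<ge> 0"
  using riesz_end_weight[OF assms(1)] square_nonneg[OF degree_end_weight_mult_le[OF assms]]
    weighted_square_nonneg[OF assms(2)] by (metis add_nonneg_nonneg)

text \<open>Cauchy-Schwarz for a semidefinite form. Since L(p^2) = 0, the value L((h + t p)^2) is
  affine in t, and t is chosen to make it -1.\<close>

lemma kernel_orthogonal:
  assumes p: "degree p \<le> s" "riesz y (p * p) = 0" and h: "degree h \<le> s"
  shows "riesz y (p * h) = 0"
proof (rule ccontr)
  define B where "B = riesz y (p * h)"
  define t where "t = - (riesz y (h * h) + 1) / (2 * B)"
  assume "riesz y (p * h) \<noteq> 0"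
  then have B: "B \<noteq> 0" by (simp add: B_def)
  have "(h + Polynomial.smult t p) * (h + Polynomial.smult t p)
      = h * h + Polynomial.smult t (p * h) + Polynomial.smult t (p * h) + Polynomial.smult (t * t) (p * p)"
    by (simp add: algebra_simps)
  then have "riesz y ((h + Polynomial.smult t p) * (h + Polynomial.smult t p))
      = riesz y (h * h) + t * B + t * B + t * t * 0"
    by (simp only: riesz_add riesz_smult B_def p(2))
  also have "\<dots> = - 1" using B by (simp add: t_def)
  finally have "riesz y ((h + Polynomial.smult t p) * (h + Polynomial.smult t p)) < 0" by simp
  moreover have "degree (h + Polynomial.smult t p) \<le> s"
    using p h by (intro degree_add_le) (auto intro: order_trans[OF degree_smult_le])
  ultimately show False using square_nonneg by fastforce
qed

text \<open>Write p = (x - \<alpha>) h. Orthogonality of p to h gives L(x h^2) = \<alpha> L(h^2),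
  and both endpoint weights are nonnegative on h^2, so \<alpha> and 1 - \<alpha> are
  nonnegative.\<close>

lemma roots_in_unit_interval:
  assumes p: "poly p \<alpha> = 0" "p \<noteq> 0" "degree p \<le> s"
    and orth: "\<And>h. degree h < degree p \<Longrightarrow> riesz y (p * h) = 0"
    and pos: "\<And>h. h \<noteq> 0 \<Longrightarrow> degree h < degree p \<Longrightarrow> riesz y (h * h) > 0"
  shows "\<alpha> \<in> {0..1}"
proof -
  obtain h where h: "p = [:-\<alpha>, 1:] * h"
    using p by (auto simp: poly_eq_0_iff_dvd elim: dvdE)
  have h0: "h \<noteq> 0" using h p by auto
  have deg: "degree p = Suc (degree h)"
    using h0 degree_mult_eq[of "[:-\<alpha>, 1:]" h] unfolding h by simp
  have "riesz y (p * h) = 0" "riesz y (h * h) > 0"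
    using orth pos h0 deg by simp_all
  moreover have "p * h = [:0, 1:] * (h * h) - Polynomial.smult \<alpha> (h * h)"
    by (simp add: h algebra_simps)
  ultimately have 1: "riesz y ([:0, 1:] * (h * h)) = \<alpha> * riesz y (h * h)"
    by (simp only: riesz_diff riesz_smult)
  have "[:1, -1:] * (h * h) = h * h - [:0, 1:] * (h * h)" by simp
  then have 2: "riesz y ([:1, -1:] * (h * h)) = (1 - \<alpha>) * riesz y (h * h)"
    using 1 by (simp only: riesz_diff left_diff_distrib)
  have "\<alpha> * riesz y (h * h) \<ge> 0" "(1 - \<alpha>) * riesz y (h * h) \<ge> 0"
    using end_weight_nonneg[of "[:0, 1:]" h] end_weight_nonneg[of "[:1, -1:]" h] 1 2 deg p
    by (simp_all only: end_weight_def) simp_all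
  then show ?thesis
    using \<open>riesz y (h * h) > 0\<close> by (auto simp: zero_le_mult_iff)
qed

text \<open>Least degree makes L(h^2) positive for nonzero h of degree below n = deg p, so the zeros
  of p are simple, lie in [0, 1] and carry positive weights. The Gauss rule gives the moments up to
  order n + s; the induction on k extends this to 2s.\<close>

lemma singular_representation:
  assumes "p \<noteq> 0" "degree p \<le> s" "riesz y (p * p) = 0"
  shows "\<exists>X c. atomic_rep (2 * s) y X c \<and> X \<subseteq> {0..1} \<and> card X \<le> s"
proof -
  define K where "K p \<longleftrightarrow> p \<noteq> 0 \<and> degree p \<le> s \<and> riesz y (p * p) = 0" for p
  have "K p" using assms by (simp add: K_def)
  then obtain p where p: "K p" and min: "\<And>h. K h \<Longrightarrow> degree p \<le> degree h"
    using ex_has_least_nat[of K p degree] by blast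
  have p0: "p \<noteq> 0" and degp: "degree p \<le> s" and pp: "riesz y (p * p) = 0"
    using p by (auto simp: K_def)
  define n where "n = degree p"
  have orth: "riesz y (p * h) = 0" if "degree h \<le> s" for h
    by (rule kernel_orthogonal[OF degp pp that])
  have pos: "riesz y (h * h) > 0" if "h \<noteq> 0" "degree h < degree p" for h
    using that min[of h] square_nonneg[of h] degp by (force simp: K_def)
  have "degree p \<noteq> 0"
  proof
    assume "degree p = 0"
    then obtain a where "p = [:a:]" by (rule degree_eq_zeroE)
    then show False using pp p0 mass_pos by (simp add: riesz_pCons)
  qed
  then have p1: "degree p > 0" by simp
  have card: "card {x. poly p x = 0} = degree p"
    by (rule orthogonal_poly_distinct_roots[of "riesz y"])
      (use p0 orth pos degp in \<open>auto simp: riesz_add riesz_smult\<close>)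
  define X where "X = {x. poly p x = 0}"
  have unit: "X \<subseteq> {0..1}"
    unfolding X_def using roots_in_unit_interval[OF _ p0 degp] orth pos degp by auto
  obtain c where c: "atomic_rep (n + s) y X c"
    using gauss_quadrature[OF p0 card, of s y] orth pos degp p1 unfolding n_def X_def by auto
  have fin: "finite X" and cpos: "\<And>x. x \<in> X \<Longrightarrow> c x > 0"
    using c by (auto simp: atomic_rep_def)
  have "y k = (\<Sum>x\<in>X. c x * x ^ k)" if "k \<le> 2 * s" for k
    using that
  proof (induction k rule: less_induct)
    case (less k)
    show ?case
    proof (cases "k \<le> n + s")
      case True
      then show ?thesis using c by (simp add: atomic_rep_def)
    next
      case False
      \<comment> \<open>The defect at an order k with n + s < k <= 2s. All smaller moments agree by
        induction.\<close>
      define \<delta> where "\<delta> = y k - (\<Sum>x\<in>X. c x * x ^ k)"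
      define y' where "y' j = (\<Sum>x\<in>X. c x * x ^ j)" for j
      have rep': "atomic_rep k y' X c"
        using fin cpos by (simp add: atomic_rep_def y'_def)
      have deg: "degree (p * monom 1 e) = n + e" for e
        using p0 by (subst degree_mult_eq) (simp_all add: degree_monom_eq n_def)
      \<comment> \<open>The polynomial w (p x^e)^2 has degree exactly k and vanishes at the nodes.
        The quadrature sum is therefore 0, and L sees only the leading coefficient times the
        defect.\<close>
      have test: "riesz y (w * (p * monom 1 e * (p * monom 1 e)))
          = lead_coeff w * (lead_coeff p)\<^sup>2 * \<delta>"
        if w: "w \<noteq> 0" and e: "degree w + 2 * (n + e) = k" for w e
      proof -
        define f where "f = w * (p * monom 1 e * (p * monom 1 e))"
        have "p * monom 1 e \<noteq> 0" using p0 by simp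
        then have degf: "degree f = k"
          unfolding f_def using w e
          by (subst degree_mult_eq, simp, simp) (subst degree_mult_eq, simp_all add: deg)
        have "coeff f k = lead_coeff f" by (simp add: degf)
        also have "\<dots> = lead_coeff w * (lead_coeff p)\<^sup>2"
          by (simp add: f_def lead_coeff_mult degree_monom_eq power2_eq_square)
        finally have cf: "coeff f k = lead_coeff w * (lead_coeff p)\<^sup>2" .
        have "riesz y f - riesz y' f = (\<Sum>j\<le>k. coeff f j * (y j - y' j))"
          by (simp add: riesz_def degf sum_subtractf right_diff_distrib)
        also have "\<dots> = (\<Sum>j\<in>{k}. coeff f j * (y j - y' j))"
          using less by (intro sum.mono_neutral_right) (auto simp: y'_def)
        also have "\<dots> = coeff f k * \<delta>" by (simp add: \<delta>_def y'_def)
        finally have "riesz y f - riesz y' f = coeff f k * \<delta>" .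
        moreover have "riesz y' f = 0"
          using rep' degf by (subst riesz_atomic_rep[OF rep']) (auto simp: f_def X_def)
        ultimately show ?thesis using cf by (simp add: f_def[symmetric])
      qed
      have lp: "(lead_coeff p)\<^sup>2 > 0" using p0 by simp
      \<comment> \<open>The weights are 1 and x(1 - x) for even k, and x and 1 - x for odd k, since
        deg w must have the parity of k. Both weights of a pair are nonnegative on squares and their
        leading coefficients are 1 and -1, which squeezes the defect to 0.\<close>
      have "(lead_coeff p)\<^sup>2 * \<delta> \<ge> 0 \<and> (lead_coeff p)\<^sup>2 * \<delta> \<le> 0"
      proof (cases "even k")
        case True
        then obtain t where t: "k = 2 * t" by (auto elim: evenE)
        have t': "t \<le> s" "n < t" using t less.prems False degp by (auto simp: n_def)
        have "riesz y (1 * (p * monom 1 (t - n) * (p * monom 1 (t - n)))) = (lead_coeff p)\<^sup>2 * \<delta>"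
          by (subst test) (use t t' in auto)
        moreover have "riesz y (1 * (p * monom 1 (t - n) * (p * monom 1 (t - n)))) \<ge> 0"
          using square_nonneg[of "p * monom 1 (t - n)"] deg t' by simp
        moreover have "riesz y ([:0, 1, -1:] * (p * monom 1 (t - n - 1) * (p * monom 1 (t - n - 1))))
            = - ((lead_coeff p)\<^sup>2 * \<delta>)"
          by (subst test) (use t t' in auto)
        moreover have "riesz y ([:0, 1, -1:] * (p * monom 1 (t - n - 1) * (p * monom 1 (t - n - 1)))) \<ge> 0"
          by (rule weighted_square_nonneg) (use deg t' in simp)
        ultimately show ?thesis by simp
      next
        case False
        then obtain t where t: "k = Suc (2 * t)" by (auto elim: oddE)
        have t': "t < s" "n \<le> t" using t less.prems \<open>\<not> k \<le> n + s\<close> degp by (auto simp: n_def)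
        have "riesz y ([:0, 1:] * (p * monom 1 (t - n) * (p * monom 1 (t - n)))) = (lead_coeff p)\<^sup>2 * \<delta>"
          by (subst test) (use t t' in auto)
        moreover have "riesz y ([:0, 1:] * (p * monom 1 (t - n) * (p * monom 1 (t - n)))) \<ge> 0"
          by (rule end_weight_nonneg) (use deg t' in \<open>auto simp: end_weight_def\<close>)
        moreover have "riesz y ([:1, -1:] * (p * monom 1 (t - n) * (p * monom 1 (t - n)))) = - ((lead_coeff p)\<^sup>2 * \<delta>)"
          by (subst test) (use t t' in auto)
        moreover have "riesz y ([:1, -1:] * (p * monom 1 (t - n) * (p * monom 1 (t - n)))) \<ge> 0"
          by (rule end_weight_nonneg) (use deg t' in \<open>auto simp: end_weight_def\<close>)
        ultimately show ?thesis by simp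
      qed
      then have "\<delta> = 0" using lp by (auto simp: mult_le_0_iff zero_le_mult_iff)
      then show ?thesis by (simp add: \<delta>_def)
    qed
  qed
  then have "atomic_rep (2 * s) y X c"
    using fin cpos by (simp add: atomic_rep_def)
  moreover have "card X \<le> s" using card degp by (simp add: X_def)
  ultimately show ?thesis using unit by blast
qed

end

section \<open>Positive definite case: quadrature with a prescribed endpoint\<close>

locale truncated_hausdorff_pos = truncated_hausdorff +
  assumes square_pos: "\<And>h. h \<noteq> 0 \<Longrightarrow> degree h \<le> s \<Longrightarrow> riesz y (h * h) > 0"
    and s_pos: "s > 0"
begin

lemma end_weight_pos:
  assumes w: "end_weight w" and h: "h \<noteq> 0" "degree h < s"
  shows "riesz y (w * (h * h)) > 0"
proof -
  have "w * h \<noteq> 0" using end_weight_neq_0[OF w] h by simp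
  then have "riesz y (w * h * (w * h)) > 0"
    by (rule square_pos) (rule degree_end_weight_mult_le[OF w h(2)])
  then show ?thesis
    using riesz_end_weight[OF w, of h] weighted_square_nonneg[OF h(2)] by linarith
qed

text \<open>Gauss-Radau quadrature: the zero of w, an endpoint of [0, 1], is a prescribed node and
  the zeros of q are the other s. Since w q is orthogonal for L itself to degree s - 1, the rule is
  exact to order (s + 1) + (s - 1) = 2s.\<close>

lemma end_weight_quadrature:
  assumes w: "end_weight w" and degq: "degree q = s"
    and orth: "\<And>h. degree h < s \<Longrightarrow> riesz y (w * (q * h)) = 0"
  shows "\<exists>c. atomic_rep (2 * s) y {x. poly (w * q) x = 0} c"
    and "{x. poly (w * q) x = 0} \<subseteq> {0..1}"
    and "card {x. poly (w * q) x = 0} = s + 1"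
proof -
  define F where "F f = riesz y (w * f)" for f
  have q0: "q \<noteq> 0" using degq s_pos by auto
  have card: "card {x. poly q x = 0} = degree q"
    by (rule orthogonal_poly_distinct_roots[of F])
      (use q0 orth degq end_weight_pos[OF w] in
        \<open>auto simp: F_def riesz_add riesz_smult distrib_left\<close>)
  \<comment> \<open>With q = (x - \<alpha>) h and w = w(\<alpha>) + \<epsilon> (x - \<alpha>),
    orthogonality gives L((w h)^2) = w(\<alpha>) L(w h^2). Both L-values are positive, so
    w(\<alpha>) > 0 and \<alpha> is not the prescribed endpoint. Moreover L(w h^2) - L((w h)^2) =
    L(x(1 - x) h^2) >= 0, so w(\<alpha>) <= 1.\<close>
  have range: "0 < poly w \<alpha> \<and> poly w \<alpha> \<le> 1" if "poly q \<alpha> = 0" for \<alpha>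
  proof -
    have "[:-\<alpha>, 1:] dvd q" using that by (simp only: poly_eq_0_iff_dvd)
    then obtain h where h: "q = [:-\<alpha>, 1:] * h" by (rule dvdE)
    have h0: "h \<noteq> 0" using h q0 by auto
    have deg: "degree h < s"
      using h0 degree_mult_eq[of "[:-\<alpha>, 1:]" h] degq unfolding h by simp
    obtain \<epsilon> where \<epsilon>: "w = [:poly w \<alpha>:] + Polynomial.smult \<epsilon> [:-\<alpha>, 1:]"
    proof -
      have "w = [:poly w \<alpha>:] + Polynomial.smult (coeff w 1) [:-\<alpha>, 1:]"
        using w by (auto simp: end_weight_def)
      then show ?thesis using that by blast
    qed
    have "(a + Polynomial.smult \<epsilon> b) * (w * (h * h)) = a * (w * (h * h)) + Polynomial.smult \<epsilon> (w * ((b * h) * h))"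
      for a b :: "real poly" by (simp add: algebra_simps)
    from this[of "[:poly w \<alpha>:]" "[:-\<alpha>, 1:]"]
    have "w * (w * (h * h)) = [:poly w \<alpha>:] * (w * (h * h)) + Polynomial.smult \<epsilon> (w * (q * h))"
      by (simp only: \<epsilon>[symmetric] h[symmetric])
    then have "riesz y (w * (w * (h * h))) = riesz y ([:poly w \<alpha>:] * (w * (h * h)))"
      by (simp only: riesz_add riesz_smult orth[OF deg])
    then have 1: "riesz y (w * h * (w * h)) = poly w \<alpha> * riesz y (w * (h * h))"
      by (simp add: riesz_smult mult_ac)
    have "w * h \<noteq> 0" using end_weight_neq_0[OF w] h0 by simp
    then have 2: "riesz y (w * h * (w * h)) > 0"
      by (rule square_pos) (rule degree_end_weight_mult_le[OF w deg])
    have 3: "riesz y (w * (h * h)) > 0" by (rule end_weight_pos[OF w h0 deg])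
    have "(1 - poly w \<alpha>) * riesz y (w * (h * h)) \<ge> 0"
      using riesz_end_weight[OF w, of h] weighted_square_nonneg[OF deg] 1
      by (simp add: left_diff_distrib)
    then show ?thesis using 1 2 3 by (auto simp: zero_less_mult_iff zero_le_mult_iff)
  qed
  obtain \<beta> where \<beta>: "\<And>x. poly w x = 0 \<longleftrightarrow> x = \<beta>" "\<beta> \<in> {0..1}"
    using w by (fastforce simp: end_weight_def)
  have roots: "{x. poly (w * q) x = 0} = insert \<beta> {x. poly q x = 0}"
    using \<beta>(1) by auto
  have "\<beta> \<notin> {x. poly q x = 0}"
    using range \<beta>(1) by fastforce
  then show card': "card {x. poly (w * q) x = 0} = s + 1"
    unfolding roots using card poly_roots_finite[OF q0] degq by simp
  show "{x. poly (w * q) x = 0} \<subseteq> {0..1}"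
    unfolding roots using range \<beta>(2) poly_end_weight_in_unit[OF w] by fastforce
  have deg: "degree (w * q) = s + 1"
    using w q0 degq by (simp add: degree_mult_eq end_weight_neq_0 degree_end_weight)
  have "\<exists>c. atomic_rep (degree (w * q) + (s - 1)) y {x. poly (w * q) x = 0} c"
  proof (rule gauss_quadrature)
    show "w * q \<noteq> 0" using q0 end_weight_neq_0[OF w] by simp
    show "card {x. poly (w * q) x = 0} = degree (w * q)" using card' deg by simp
    show "riesz y (w * q * h) = 0" if "degree h \<le> s - 1" for h
      using orth[of h] that s_pos by (simp add: mult.assoc)
  qed (use deg square_pos in auto)
  then show "\<exists>c. atomic_rep (2 * s) y {x. poly (w * q) x = 0} c"
    using deg s_pos by (simp add: mult_2)
qed

text \<open>The polynomial w q^2 has degree 2s + 1, one beyond the given moments. Its integral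
  depends on the representation only through that of w x^(2s); the subtracted quadratic form is
  common to all of them.\<close>

lemma end_weight_orthogonal_poly:
  assumes w: "end_weight w"
    and M: "M = mat s s (\<lambda>(i,j). riesz y (w * monom 1 (i + j)))"
    and z: "z = vec s (\<lambda>i. riesz y (w * monom 1 (s + i)))"
  obtains q where "degree q = s" "\<And>h. degree h < s \<Longrightarrow> riesz y (w * (q * h)) = 0"
    "\<And>X c. atomic_rep (2 * s) y X c \<Longrightarrow>
      (\<Sum>x\<in>X. c x * (poly w x * (poly q x)\<^sup>2))
        = (\<Sum>x\<in>X. c x * (poly w x * x ^ (2 * s))) - scalar_prod z (pinv M *\<^sub>v z)"
proof -
  define m where "m = (\<lambda>k. riesz y (w * monom 1 k))"
  have "riesz m (h * h) > 0" if "h \<noteq> 0" "degree h < s" for h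
    using end_weight_pos[OF w that] by (simp add: m_def riesz_weight)
  then obtain q where q: "degree q = s"
    "\<And>m' h. (\<And>k. k < 2 * s \<Longrightarrow> m' k = m k) \<Longrightarrow> degree h < s \<Longrightarrow> riesz m' (q * h) = 0"
    "\<And>m'. (\<And>k. k < 2 * s \<Longrightarrow> m' k = m k) \<Longrightarrow>
      riesz m' (q * q) = m' (2 * s) - scalar_prod z (pinv M *\<^sub>v z)"
    using orthogonal_poly_pinv[of s m M z] s_pos M z unfolding m_def by blast
  have orth: "riesz y (w * (q * h)) = 0" if "degree h < s" for h
    using q(2)[of m h] that by (simp add: m_def riesz_weight)
  have "(\<Sum>x\<in>X. c x * (poly w x * (poly q x)\<^sup>2))
        = (\<Sum>x\<in>X. c x * (poly w x * x ^ (2 * s))) - scalar_prod z (pinv M *\<^sub>v z)"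
    if rep: "atomic_rep (2 * s) y X c" for X c
  proof -
    \<comment> \<open>The full moment sequence of the given atoms. It agrees with y up to order 2s,
      and w has degree 1, so the weighted sequences agree below 2s.\<close>
    define y' where "y' k = (\<Sum>x\<in>X. c x * x ^ k)" for k
    define m' where "m' = (\<lambda>k. riesz y' (w * monom 1 k))"
    have rep': "atomic_rep D y' X c" for D
      using rep by (simp add: atomic_rep_def y'_def)
    have "m' k = m k" if "k < 2 * s" for k
      unfolding m'_def m_def
    proof (rule riesz_cong)
      show "degree (w * monom 1 k) \<le> 2 * s"
        using degree_mult_le[of w "monom 1 k"] degree_end_weight[OF w] that
        by (simp add: degree_monom_eq)
    qed (use rep in \<open>simp add: y'_def atomic_rep_def\<close>)
    then have "riesz m' (q * q) = m' (2 * s) - scalar_prod z (pinv M *\<^sub>v z)" by (rule q(3))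
    moreover have "riesz m' (q * q) = (\<Sum>x\<in>X. c x * (poly w x * (poly q x)\<^sup>2))"
      unfolding m'_def riesz_weight
      by (subst riesz_atomic_rep[OF rep' order_refl]) (simp add: power2_eq_square)
    moreover have "m' (2 * s) = (\<Sum>x\<in>X. c x * (poly w x * x ^ (2 * s)))"
      unfolding m'_def
      by (subst riesz_atomic_rep[OF rep' order_refl]) (simp add: poly_monom)
    ultimately show ?thesis by simp
  qed
  with q(1) orth show ?thesis using that by blast
qed

text \<open>The integral of w q^2 is 0 for the Gauss-Radau measure, whose nodes are the zeros of w
  q, and nonnegative for every atomic measure on [0, 1]. For w = x and w = 1 - x this yields the
  lower and upper principal representations of y.\<close>

lemma principal_representation:
  assumes w: "end_weight w"
    and M: "M = mat s s (\<lambda>(i,j). riesz y (w * monom 1 (i + j)))"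
    and z: "z = vec s (\<lambda>i. riesz y (w * monom 1 (s + i)))"
  shows "\<exists>X c. atomic_rep (2 * s) y X c \<and> X \<subseteq> {0..1} \<and> card X = s + 1 \<and>
      (\<Sum>x\<in>X. c x * (poly w x * x ^ (2 * s))) = scalar_prod z (pinv M *\<^sub>v z)"
    and "\<And>X c. atomic_rep (2 * s) y X c \<Longrightarrow> X \<subseteq> {0..1} \<Longrightarrow>
      scalar_prod z (pinv M *\<^sub>v z) \<le> (\<Sum>x\<in>X. c x * (poly w x * x ^ (2 * s)))"
proof -
  obtain q where q: "degree q = s" "\<And>h. degree h < s \<Longrightarrow> riesz y (w * (q * h)) = 0"
    and gap: "\<And>X c. atomic_rep (2 * s) y X c \<Longrightarrow>
      (\<Sum>x\<in>X. c x * (poly w x * (poly q x)\<^sup>2))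
        = (\<Sum>x\<in>X. c x * (poly w x * x ^ (2 * s))) - scalar_prod z (pinv M *\<^sub>v z)"
    using end_weight_orthogonal_poly[OF w M z] by blast
  note quad = end_weight_quadrature[OF w q]
  obtain c where c: "atomic_rep (2 * s) y {x. poly (w * q) x = 0} c"
    using quad(1) by blast
  have "(\<Sum>x\<in>{x. poly (w * q) x = 0}. c x * (poly w x * (poly q x)\<^sup>2)) = 0"
    by (rule sum.neutral) auto
  then show "\<exists>X c. atomic_rep (2 * s) y X c \<and> X \<subseteq> {0..1} \<and> card X = s + 1 \<and>
      (\<Sum>x\<in>X. c x * (poly w x * x ^ (2 * s))) = scalar_prod z (pinv M *\<^sub>v z)"
    using c quad(2,3) gap[OF c] by (intro exI[of _ "{x. poly (w * q) x = 0}"] exI[of _ c]) simp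
  show "scalar_prod z (pinv M *\<^sub>v z) \<le> (\<Sum>x\<in>X. c x * (poly w x * x ^ (2 * s)))"
    if rep: "atomic_rep (2 * s) y X c" and X: "X \<subseteq> {0..1}" for X c
  proof -
    have "(\<Sum>x\<in>X. c x * (poly w x * (poly q x)\<^sup>2)) \<ge> 0"
      using rep X poly_end_weight_nonneg[OF w]
      by (intro sum_nonneg mult_nonneg_nonneg) (auto simp: atomic_rep_def less_imp_le subset_iff)
    then show ?thesis using gap[OF rep] by simp
  qed
qed

end

section \<open>Representing measures\<close>

text \<open>The Lagrange polynomial at a isolates the weight there and has degree at most D. Signs
  are left open because point masses of an arbitrary representing measure are compared with c before
  they are known to be positive.\<close>

lemma quadrature_weights_unique:
  fixes X :: "real set"
  assumes "finite X" "card X \<le> D + 1"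
    and "\<And>k. k \<le> D \<Longrightarrow> (\<Sum>x\<in>X. c x * x ^ k) = (\<Sum>x\<in>X. c' x * x ^ k)" "a \<in> X"
  shows "c a = c' a"
proof -
  define y where "y k = (\<Sum>x\<in>X. c x * x ^ k)" for k
  have deg: "degree (lagrange X a) \<le> D"
    using assms by (simp add: degree_lagrange)
  have "c a = riesz y (lagrange X a)"
    using deg assms(1,4) by (subst riesz_quadrature[where D = D and X = X and c = c]) (auto simp: y_def sum_lagrange)
  also have "\<dots> = c' a"
    using deg assms(1,3,4) by (subst riesz_quadrature[where D = D and X = X and c = c']) (auto simp: y_def sum_lagrange)
  finally show ?thesis .
qed

text \<open>The push-forward along the identity replaces the power set of X by the Borel sets that
  \<open>rep_measure\<close> demands.\<close>

definition atomic_measure :: "real set \<Rightarrow> (real \<Rightarrow> real) \<Rightarrow> real measure" where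
  "atomic_measure X c = distr (point_measure X (\<lambda>x. ennreal (c x))) borel (\<lambda>x. x)"

lemma sets_atomic_measure [simp]: "sets (atomic_measure X c) = sets borel"
  by (simp add: atomic_measure_def)

lemma emeasure_atomic_measure:
  assumes "finite X" "B \<in> sets borel"
  shows "emeasure (atomic_measure X c) B = (\<Sum>x\<in>X \<inter> B. ennreal (c x))"
  using assms
  by (simp add: atomic_measure_def emeasure_distr space_point_measure emeasure_point_measure_finite
      Int_commute)

lemma integral_atomic_measure:
  assumes "finite X" "\<And>x. x \<in> X \<Longrightarrow> c x \<ge> 0" "f \<in> borel_measurable borel"
  shows "integrable (atomic_measure X c) f" "(\<integral>x. f x \<partial>atomic_measure X c) = (\<Sum>x\<in>X. c x * f x)"
  using assms
  by (simp_all add: atomic_measure_def integrable_distr_eq integral_distr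
      integrable_point_measure_finite lebesgue_integral_point_measure_finite)

lemma rep_measure_atomic_measure:
  assumes "atomic_rep D y X c"
  shows "rep_measure D y (atomic_measure X c)"
  using assms by (auto simp: rep_measure_def atomic_rep_def integral_atomic_measure less_imp_le)

lemma msupport_atomic_measure:
  assumes X: "finite X" and c: "\<And>x. x \<in> X \<Longrightarrow> c x > 0"
  shows "msupport (atomic_measure X c) = X"
proof (intro equalityI subsetI)
  fix x assume x: "x \<in> X"
  have "emeasure (atomic_measure X c) U > 0" if "open U" "x \<in> U" for U
    using that x X c
    by (auto simp: emeasure_atomic_measure zero_less_iff_neq_zero sum_eq_0_iff ennreal_eq_0_iff not_le)
  then show "x \<in> msupport (atomic_measure X c)" by (auto simp: msupport_def)
next
  fix x assume x: "x \<in> msupport (atomic_measure X c)"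
  show "x \<in> X"
  proof (rule ccontr)
    assume "x \<notin> X"
    moreover have "open (- X)" using X by (simp add: finite_imp_closed open_Compl)
    ultimately have "emeasure (atomic_measure X c) (- X) > 0"
      using x by (auto simp: msupport_def)
    then show False using X by (simp add: emeasure_atomic_measure finite_imp_closed open_Compl borel_open)
  qed
qed

lemma atomic_measure_cong:
  "(\<And>x. x \<in> X \<Longrightarrow> c x = c' x) \<Longrightarrow> finite X \<Longrightarrow> atomic_measure X c = atomic_measure X c'"
  by (intro measure_eqI) (auto simp: emeasure_atomic_measure intro!: sum.cong)

lemma atomic_measure_inject:
  assumes "atomic_rep D y X c" "atomic_rep D' y' X' c'"
    and eq: "atomic_measure X c = atomic_measure X' c'"
  shows "X = X'" "\<And>x. x \<in> X \<Longrightarrow> c x = c' x"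
proof -
  have *: "finite X" "\<And>x. x \<in> X \<Longrightarrow> c x > 0" "finite X'" "\<And>x. x \<in> X' \<Longrightarrow> c' x > 0"
    using assms(1,2) by (auto simp: atomic_rep_def)
  show XX: "X = X'"
    using eq msupport_atomic_measure[of X c] msupport_atomic_measure[of X' c'] * by simp
  fix x assume x: "x \<in> X"
  have "emeasure (atomic_measure X c) {x} = emeasure (atomic_measure X' c') {x}"
    by (simp add: eq)
  moreover have "X \<inter> {x} = {x}" "X' \<inter> {x} = {x}" using x XX by auto
  ultimately have "ennreal (c x) = ennreal (c' x)"
    using * x XX by (simp add: emeasure_atomic_measure)
  then show "c x = c' x" using * x XX by (simp add: less_imp_le)
qed

section \<open>Arbitrary representing measures\<close>

context
  fixes D :: nat and y :: "nat \<Rightarrow> real" and \<mu> :: "real measure"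
  assumes rep: "rep_measure D y \<mu>"
begin

lemma rep_measure_finite: "finite_measure \<mu>"
proof -
  have "integrable \<mu> (\<lambda>x. x ^ 0)" using rep unfolding rep_measure_def by blast
  then have "integrable \<mu> (\<lambda>x. 1 :: real)" by simp
  then have "emeasure \<mu> (space \<mu>) < \<infinity>"
    by (simp add: integrable_iff_bounded)
  then show ?thesis by (intro finite_measureI) auto
qed

lemma rep_measure_poly:
  assumes "degree p \<le> D"
  shows "integrable \<mu> (\<lambda>x. poly p x)" "(\<integral>x. poly p x \<partial>\<mu>) = riesz y p"
proof -
  have *: "integrable \<mu> (\<lambda>x. coeff p i * x ^ i)" "(\<integral>x. coeff p i * x ^ i \<partial>\<mu>) = coeff p i * y i"
    if "i \<le> degree p" for i
    using rep assms that by (simp_all add: rep_measure_def)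
  show "integrable \<mu> (\<lambda>x. poly p x)"
    unfolding poly_altdef by (rule Bochner_Integration.integrable_sum) (rule *(1), simp)
  show "(\<integral>x. poly p x \<partial>\<mu>) = riesz y p"
    unfolding poly_altdef riesz_def
    by (rule trans[OF Bochner_Integration.integral_sum sum.cong[OF refl *(2)]]) ((rule *(1))?, simp)+
qed

lemma rep_measure_concentrated:
  assumes X: "finite X" and AE: "AE x in \<mu>. x \<in> X"
  shows "\<mu> = atomic_measure X (\<lambda>x. measure \<mu> {x})"
    and "k \<le> D \<Longrightarrow> y k = (\<Sum>x\<in>X. measure \<mu> {x} * x ^ k)"
proof -
  interpret finite_measure \<mu> by (rule rep_measure_finite)
  have sets: "sets \<mu> = sets borel" using rep by (simp add: rep_measure_def)
  show eq: "\<mu> = atomic_measure X (\<lambda>x. measure \<mu> {x})"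
  proof (rule measure_eqI)
    fix B assume B: "B \<in> sets \<mu>"
    have "finite (X \<inter> B)" using X by simp
    have "emeasure \<mu> B = emeasure \<mu> (X \<inter> B)"
      by (rule emeasure_eq_AE) (use AE B X sets in \<open>auto simp: finite_imp_closed borel_closed intro!: sets.Int\<close>)
    also have "\<dots> = (\<Sum>x\<in>X \<inter> B. emeasure \<mu> {x})"
      by (rule emeasure_eq_sum_singleton) (use X sets in auto)
    also have "\<dots> = emeasure (atomic_measure X (\<lambda>x. measure \<mu> {x})) B"
      using X B sets by (simp add: emeasure_atomic_measure emeasure_eq_measure)
    finally show "emeasure \<mu> B = emeasure (atomic_measure X (\<lambda>x. measure \<mu> {x})) B" .
  qed (simp add: sets)
  assume "k \<le> D"
  then have "y k = (\<integral>x. x ^ k \<partial>\<mu>)" using rep by (simp add: rep_measure_def)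
  also have "\<dots> = (\<integral>x. x ^ k \<partial>atomic_measure X (\<lambda>x. measure \<mu> {x}))"
    using eq by simp
  also have "\<dots> = (\<Sum>x\<in>X. measure \<mu> {x} * x ^ k)"
    using X by (subst integral_atomic_measure) auto
  finally show "y k = (\<Sum>x\<in>X. measure \<mu> {x} * x ^ k)" .
qed

text \<open>The complement of the support is a union of open null sets; by Lindelof countably many
  of them suffice.\<close>

lemma AE_in_msupport: "AE x in \<mu>. x \<in> msupport \<mu>"
proof -
  define \<F> where "\<F> = {U. open U \<and> emeasure \<mu> U = 0}"
  have sets: "sets \<mu> = sets borel" using rep by (simp add: rep_measure_def)
  obtain \<F>' where F': "\<F>' \<subseteq> \<F>" "countable \<F>'" "\<Union>\<F>' = \<Union>\<F>"
    using Lindelof[of \<F>] by (auto simp: \<F>_def)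
  have "\<Union>\<F>' \<in> null_sets \<mu>"
    using F'(1,2) by (intro null_sets_UN'[where N = id, simplified]) (auto simp: \<F>_def sets null_sets_def)
  moreover have "\<Union>\<F> = - msupport \<mu>"
    by (auto simp: \<F>_def msupport_def zero_less_iff_neq_zero)
  ultimately show ?thesis
    using F'(3) by (auto intro: AE_I')
qed

lemma rep_measure_finite_support:
  assumes fin: "finite (msupport \<mu>)"
  shows "\<mu> = atomic_measure (msupport \<mu>) (\<lambda>x. measure \<mu> {x})"
    and "atomic_rep D y (msupport \<mu>) (\<lambda>x. measure \<mu> {x})"
proof -
  interpret finite_measure \<mu> by (rule rep_measure_finite)
  note conc = rep_measure_concentrated[OF fin AE_in_msupport]
  show eq: "\<mu> = atomic_measure (msupport \<mu>) (\<lambda>x. measure \<mu> {x})" by (rule conc(1))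
  have "measure \<mu> {x} > 0" if x: "x \<in> msupport \<mu>" for x
  proof -
    \<comment> \<open>An open set meeting the support in x alone, so its positive mass sits at
      x.\<close>
    define U where "U = - (msupport \<mu> - {x})"
    have "closed (msupport \<mu> - {x})" using fin by (simp add: finite_imp_closed)
    then have U: "open U" "x \<in> U" unfolding U_def by (blast intro: open_Compl)+
    then have "0 < emeasure \<mu> U" using x by (auto simp: msupport_def)
    also have "emeasure \<mu> U = emeasure (atomic_measure (msupport \<mu>) (\<lambda>x. measure \<mu> {x})) U"
      using eq by simp
    also have "\<dots> = (\<Sum>x\<in>msupport \<mu> \<inter> U. ennreal (measure \<mu> {x}))"
      using fin U by (simp add: emeasure_atomic_measure)
    also have "msupport \<mu> \<inter> U = {x}" using x by (auto simp: U_def)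
    finally show ?thesis by simp
  qed
  then show "atomic_rep D y (msupport \<mu>) (\<lambda>x. measure \<mu> {x})"
    using fin conc(2) by (simp add: atomic_rep_def)
qed

end

text \<open>The square of the node polynomial has integral zero, so every representing measure lives on
  the nodes.\<close>

lemma rep_measure_unique:
  assumes rep: "atomic_rep (2 * s) y X c" and card: "card X \<le> s" and \<mu>: "rep_measure (2 * s) y \<mu>"
  shows "\<mu> = atomic_measure X c"
proof -
  define P where "P = node_poly X * node_poly X"
  have X: "finite X" using rep by (simp add: atomic_rep_def)
  \<comment> \<open>Here at most s nodes matter: the squared node polynomial must stay within the
    given moments.\<close>
  have deg: "degree P \<le> 2 * s"
    using card degree_mult_le[of "node_poly X" "node_poly X"] by (simp add: P_def degree_node_poly)
  have "(\<integral>x. poly P x \<partial>\<mu>) = (\<Sum>x\<in>X. c x * poly P x)"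
    using rep_measure_poly(2)[OF \<mu> deg] riesz_atomic_rep[OF rep deg] by simp
  also have "\<dots> = 0"
    using X by (intro sum.neutral) (auto simp: P_def poly_node_poly_eq_0_iff)
  finally have "AE x in \<mu>. poly P x = 0"
    using integral_nonneg_eq_0_iff_AE[OF rep_measure_poly(1)[OF \<mu> deg]] by (simp add: P_def)
  then have AE: "AE x in \<mu>. x \<in> X"
    by eventually_elim (use X in \<open>simp add: P_def poly_node_poly_eq_0_iff\<close>)
  note conc = rep_measure_concentrated[OF \<mu> X AE]
  have "measure \<mu> {x} = c x" if "x \<in> X" for x
  proof (rule quadrature_weights_unique[where c = "\<lambda>x. measure \<mu> {x}" and c' = c and X = X and D = "2 * s"])
    show "(\<Sum>x\<in>X. measure \<mu> {x} * x ^ k) = (\<Sum>x\<in>X. c x * x ^ k)" if "k \<le> 2 * s" for k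
      using rep conc(2)[OF that] that by (simp add: atomic_rep_def)
  qed (use card that X in auto)
  then show ?thesis
    using conc(1) atomic_measure_cong[OF _ X] by metis
qed

text \<open>The nodes are the zeros of the monic polynomial orthogonal to all polynomials of degree at
  most K, which the linear system determines.\<close>

lemma node_poly_linear_system:
  assumes rep: "atomic_rep (K + r) y X c" and card: "card X = r" and r: "r > 0" "r \<le> K + 1"
  shows "length g = r \<and> (\<forall>i\<le>K. (\<Sum>j<r. y (i + j) * g ! j) = y (i + r))
    \<longleftrightarrow> g = map (\<lambda>j. - coeff (node_poly X) j) [0..<r]"
    (is "?L \<longleftrightarrow> ?R")
proof -
  define N where "N = node_poly X"
  have X: "finite X" using rep by (simp add: atomic_rep_def)
  have degN: "degree N = r" by (simp add: N_def degree_node_poly card)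
  have cN: "coeff N r = 1" using lead_coeff_node_poly[of X] by (simp add: N_def degree_node_poly card)
  \<comment> \<open>The negative of the polynomial g(x) in the theorem, hence monic. By
    \<open>sys\<close> the linear system says that it is orthogonal to x^i for i <= K.\<close>
  define P where "P = (\<lambda>g :: real list. monom 1 r - (\<Sum>j<r. monom (g ! j) j))"
  have cP: "coeff (P g) j = (if j < r then - g ! j else if j = r then 1 else 0)" for g j
    by (simp add: P_def coeff_sum_monom)
  have degP: "degree (P g) \<le> r" for g
    by (rule degree_le) (simp add: cP)
  have PN: "P g = N" if "g = map (\<lambda>j. - coeff N j) [0..<r]" for g
    by (rule poly_eqI) (use that cN degN in \<open>auto simp: cP coeff_eq_0\<close>)
  have sys: "riesz y (P g * monom 1 i) = y (i + r) - (\<Sum>j<r. y (i + j) * g ! j)" for g i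
  proof -
    have "riesz y (P g * monom 1 i) = y (r + i) - (\<Sum>j<r. g ! j * y (j + i))"
      by (simp add: P_def left_diff_distrib sum_distrib_right mult_monom riesz_diff riesz_sum
          riesz_monom)
    then show ?thesis by (simp add: add.commute mult.commute)
  qed
  have N: "riesz y (N * h) = 0" if "degree h \<le> K" for h
    using degree_mult_le[of N h] that degN X
    by (subst riesz_atomic_rep[OF rep]) (auto simp: N_def poly_node_poly_eq_0_iff intro!: sum.neutral)
  show ?thesis
  proof
    assume L: ?L
    \<comment> \<open>Two monic candidates differ by E of degree below r. As r <= K + 1, E is
      orthogonal to itself, and with r nodes L(E^2) = 0 forces E = 0.\<close>
    define E where "E = P g - N"
    have "degree E < r"
    proof -
      have "degree E \<le> r - 1"
        by (rule degree_le) (use r cN degN in \<open>auto simp: E_def cP coeff_eq_0\<close>)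
      then show ?thesis using r by linarith
    qed
    have orth: "riesz y (E * monom 1 i) = 0" if "i \<le> K" for i
      using L that sys[of g i] N[of "monom 1 i"]
      by (simp add: E_def left_diff_distrib riesz_diff degree_monom_eq)
    have "E * E = (\<Sum>i<r. Polynomial.smult (coeff E i) (E * monom 1 i))"
      by (subst (2) poly_as_sum_of_monoms_less[OF \<open>degree E < r\<close>, symmetric])
        (simp add: sum_distrib_left mult_smult_right[symmetric] smult_monom del: mult_smult_right)
    then have "riesz y (E * E) = 0"
      using orth r by (simp add: riesz_sum riesz_smult)
    then have "E = 0"
      using riesz_square_pos_of_atomic_rep[OF rep, of E] \<open>degree E < r\<close> card r by fastforce
    then have "coeff (P g) j = coeff N j" for j by (simp add: E_def)
    then have "g ! j = - coeff N j" if "j < r" for j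
      using cP[of g j] that by fastforce
    then show ?R using L by (auto simp: N_def intro!: nth_equalityI)
  next
    assume R: ?R
    then have "P g = N" by (intro PN) (simp add: N_def)
    then have "y (i + r) - (\<Sum>j<r. y (i + j) * g ! j) = 0" if "i \<le> K" for i
      using sys[of g i] N[of "monom 1 i"] that by (simp add: degree_monom_eq)
    then show ?L using R by auto
  qed
qed

lemma node_poly_eq_sum_monom:
  assumes "card X = r" "g = map (\<lambda>j. - coeff (node_poly X) j) [0..<r]"
  shows "(\<Sum>j<r. monom (g ! j) j) - monom 1 r = - node_poly X"
  using lead_coeff_node_poly[of X] assms
  by (intro poly_eqI) (auto simp: coeff_sum_monom coeff_eq_0 degree_node_poly)

section \<open>Symmetric tensors\<close>

lemma idx_Suc: "idx (Suc n) = (\<lambda>(js, j). js @ [j]) ` (idx n \<times> {0, 1})"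
proof (intro equalityI subsetI)
  fix xs assume "xs \<in> idx (Suc n)"
  then have xs: "length xs = Suc n" "set xs \<subseteq> {0, 1}" by (auto simp: idx_def)
  then have "xs \<noteq> []" by auto
  then obtain js j where "xs = js @ [j]" by (metis rev_exhaust)
  then show "xs \<in> (\<lambda>(js, j). js @ [j]) ` (idx n \<times> {0, 1})"
    using xs by (intro image_eqI[of _ _ "(js, j)"]) (auto simp: idx_def)
qed (auto simp: idx_def)

lemma finite_idx: "finite (idx n)"
proof (induction n)
  case 0
  have "idx 0 = {[]}" by (auto simp: idx_def)
  then show ?case by simp
qed (simp add: idx_Suc)

text \<open>Multiplying out the product: \<open>js\<close> records which term is taken from each
  factor.\<close>

lemma sum_idx_prod:
  fixes f :: "nat \<Rightarrow> nat \<Rightarrow> real"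
  shows "(\<Sum>js\<in>idx n. \<Prod>k<n. f k (js ! k)) = (\<Prod>k<n. f k 0 + f k 1)"
proof (induction n)
  case 0
  have "idx 0 = {[]}" by (auto simp: idx_def)
  then show ?case by simp
next
  case (Suc n)
  have "(\<Sum>js\<in>idx (Suc n). \<Prod>k<Suc n. f k (js ! k))
      = (\<Sum>(js, j)\<in>idx n \<times> {0, 1}. \<Prod>k<Suc n. f k ((js @ [j]) ! k))"
    unfolding idx_Suc by (subst sum.reindex) (auto simp: inj_on_def case_prod_unfold)
  also have "\<dots> = (\<Sum>(js, j)\<in>idx n \<times> {0, 1}. (\<Prod>k<n. f k (js ! k)) * f n j)"
  proof (rule sum.cong)
    fix p :: "nat list \<times> nat" assume "p \<in> idx n \<times> {0, 1}"
    then obtain js j where p: "p = (js, j)" "length js = n" by (auto simp: idx_def)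
    then show "(case p of (js, j) \<Rightarrow> \<Prod>k<Suc n. f k ((js @ [j]) ! k))
        = (case p of (js, j) \<Rightarrow> (\<Prod>k<n. f k (js ! k)) * f n j)"
      by (auto simp: nth_append intro!: prod.cong)
  qed simp
  also have "\<dots> = (\<Sum>js\<in>idx n. (\<Prod>k<n. f k (js ! k)) * (f n 0 + f n 1))"
    by (simp add: sum.cartesian_product[symmetric] distrib_left)
  also have "\<dots> = (\<Prod>k<Suc n. f k 0 + f k 1)"
    by (simp add: Suc.IH sum_distrib_right[symmetric])
  finally show ?case .
qed

lemma LT_tpow:
  assumes "is \<in> idx d"
  shows "LT T d (tpow v d) is = (\<Prod>k<d. T (is ! k) 0 * fst v + T (is ! k) 1 * snd v)"
proof -
  have "LT T d (tpow v d) is = (\<Sum>js\<in>idx d. \<Prod>k<d. T (is ! k) (js ! k) * comp v (js ! k))"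
    using assms by (simp add: LT_def tpow_def prod.distrib)
  also have "\<dots> = (\<Prod>k<d. T (is ! k) 0 * comp v 0 + T (is ! k) 1 * comp v 1)"
    by (rule sum_idx_prod)
  finally show ?thesis by (simp add: comp_def)
qed

lemma replicate_in_idx: "k \<le> d \<Longrightarrow> replicate (d - k) 0 @ replicate k 1 \<in> idx d"
  by (auto simp: idx_def)

text \<open>Here T (a, b) = (a + b, b). The division-free form covers the zero vector too, which has
  no position b / (a + b).\<close>

lemma Bvec_LT_tpow:
  assumes "k \<le> d"
  shows "Bvec d (LT Tup d (tpow v d)) k = (fst v + snd v) ^ (d - k) * snd v ^ k"
proof -
  let ?b = "replicate (d - k) 0 @ replicate k (1::nat)"
  have "Bvec d (LT Tup d (tpow v d)) k
      = (\<Prod>i<d. Tup (?b ! i) 0 * fst v + Tup (?b ! i) 1 * snd v)"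
    unfolding Bvec_def by (rule LT_tpow[OF replicate_in_idx[OF assms]])
  also have "\<dots> = (\<Prod>i<d. if i < d - k then fst v + snd v else snd v)"
    by (rule prod.cong) (auto simp: nth_append Tup_def)
  also have "\<dots> = (fst v + snd v) ^ (d - k) * snd v ^ k"
  proof -
    have "{..<d} \<inter> {i. i < d - k} = {..<d - k}" "{..<d} \<inter> - {i. i < d - k} = {d - k..<d}"
      by auto
    then show ?thesis
      using assms by (simp add: prod.If_cases)
  qed
  finally show ?thesis .
qed

lemma Bvec_LT_tsum:
  assumes "k \<le> d"
  shows "Bvec d (LT Tup d (tsum d vs)) k = (\<Sum>v\<leftarrow>vs. (fst v + snd v) ^ (d - k) * snd v ^ k)"
proof -
  have "Bvec d (LT Tup d (tsum d vs)) k = (\<Sum>v\<leftarrow>vs. Bvec d (LT Tup d (tpow v d)) k)"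
    using replicate_in_idx[OF assms]
    by (induction vs) (simp_all add: Bvec_def LT_def tsum_def distrib_left sum.distrib)
  then show ?thesis using assms by (simp add: Bvec_LT_tpow)
qed

lemma tpow_eq_prod_mset:
  assumes "is \<in> idx d"
  shows "tpow v d is = prod_mset (image_mset (comp v) (mset is))"
proof -
  have "tpow v d is = (\<Prod>k = 0..<length is. comp v (is ! k))"
    using assms by (simp add: tpow_def idx_def atLeast0LessThan)
  also have "\<dots> = prod_list (map (comp v) is)"
    by (simp add: prod.list_conv_set_nth)
  finally show ?thesis by (simp add: prod_mset_prod_list[symmetric])
qed

lemma tsum_in_Sym: "tsum d vs \<in> Sym d"
proof -
  have "tsum d vs is = 0" if "is \<notin> idx d" for "is"
    using that by (simp add: tsum_def tpow_def)
  moreover have "tsum d vs is = tsum d vs js" if "is \<in> idx d" "js \<in> idx d" "mset is = mset js" for "is" js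
    using that by (simp add: tsum_def tpow_eq_prod_mset)
  ultimately show ?thesis unfolding Sym_def by blast
qed

lemma count_mset_eq_card: "count (mset xs) x = card {i. i < length xs \<and> xs ! i = x}"
  unfolding count_mset count_list_eq_length_filter length_filter_conv_card by (rule arg_cong[where f = card]) auto

lemma mset_idx_eq:
  assumes "is \<in> idx d" "js \<in> idx d" "count (mset is) 1 = count (mset js) 1"
  shows "mset is = mset js"
proof (rule multiset_eqI)
  have *: "count (mset xs) 0 + count (mset xs) (1::nat) = length xs" if "set xs \<subseteq> {0, 1}" for xs
    using that by (induction xs) auto
  fix i :: nat
  show "count (mset is) i = count (mset js) i"
  proof (cases "i \<in> {0, 1}")
    case True
    then show ?thesis
      using assms *[of "is"] *[of js] by (auto simp: idx_def)
  next
    case False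
    then have "i \<notin> set is" "i \<notin> set js" using assms by (auto simp: idx_def)
    then show ?thesis by (simp add: count_mset count_list_0_iff)
  qed
qed

text \<open>The transform is triangular with respect to the number of ones in an index: the entry of
  the transformed tensor with k trailing ones involves only indices with at least k ones.\<close>

lemma Sym_eqI:
  assumes A: "A \<in> Sym d" and B: "B \<in> Sym d"
    and eq: "\<And>k. k \<le> d \<Longrightarrow> Bvec d (LT Tup d A) k = Bvec d (LT Tup d B) k"
  shows "A = B"
proof
  define D where "D = (\<lambda>is. A is - B is)"
  have Dsym: "D is = D js" if "is \<in> idx d" "js \<in> idx d" "mset is = mset js" for "is" js
  proof -
    have "A is = A js" "B is = B js" using A B that unfolding Sym_def by blast+
    then show ?thesis by (simp add: D_def)
  qed
  have "D is = 0" if "is \<in> idx d" for "is"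
    using that
  proof (induction "d - count (mset is) 1" arbitrary: "is" rule: less_induct)
    case less
    define c where "c = count (mset is) 1"
    define b where "b = replicate (d - c) 0 @ replicate c (1::nat)"
    have cd: "c \<le> d"
      using less.prems count_le_size[of "mset is" 1] by (simp add: c_def idx_def)
    have b: "b \<in> idx d" unfolding b_def by (rule replicate_in_idx[OF cd])
    have "Bvec d (LT Tup d A) c - Bvec d (LT Tup d B) c = 0" using eq[OF cd] by simp
    also have "Bvec d (LT Tup d A) c - Bvec d (LT Tup d B) c
        = (\<Sum>js\<in>idx d. (\<Prod>k<d. Tup (b ! k) (js ! k)) * D js)"
      by (simp only: Bvec_def b_def[symmetric] LT_def b if_True D_def right_diff_distrib sum_subtractf)
    \<comment> \<open>A zero of \<open>js\<close> among the last c positions makes the product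
      vanish. Otherwise \<open>js\<close> differs from b by a one further left, so it has more than
      c ones and D vanishes there by induction.\<close>
    also have "\<dots> = (\<Sum>js\<in>{b}. (\<Prod>k<d. Tup (b ! k) (js ! k)) * D js)"
    proof (rule sum.mono_neutral_right[OF finite_idx])
      show "\<forall>js\<in>idx d - {b}. (\<Prod>k<d. Tup (b ! k) (js ! k)) * D js = 0"
      proof
        fix js assume js: "js \<in> idx d - {b}"
        then have len: "length js = d" "set js \<subseteq> {0, 1}" by (auto simp: idx_def)
        have js01: "js ! k = 0 \<or> js ! k = 1" if "k < d" for k
          using subsetD[OF len(2) nth_mem[of k js]] len(1) that by auto
        show "(\<Prod>k<d. Tup (b ! k) (js ! k)) * D js = 0"
        proof (cases "\<exists>k\<in>{d - c..<d}. js ! k = 0")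
          case True
          then obtain k where k: "d - c \<le> k" "k < d" "js ! k = 0" by auto
          then have "Tup (b ! k) (js ! k) = 0" by (simp add: b_def nth_append Tup_def)
          then have "(\<Prod>k<d. Tup (b ! k) (js ! k)) = 0"
            using k by (intro prod_zero bexI[of _ k]) auto
          then show ?thesis by simp
        next
          case False
          then have tail: "js ! k = 1" if "d - c \<le> k" "k < d" for k
            using js01 that by fastforce
          have "js \<noteq> b" "length b = d" using js b by (auto simp: idx_def)
          then obtain k where k: "k < d" "js ! k \<noteq> b ! k"
            using nth_equalityI[of js b] len(1) by auto
          then have kc: "k < d - c" "js ! k = 1"
            using tail js01[of k] by (auto simp: b_def nth_append split: if_splits)
          have "insert k {d - c..<d} \<subseteq> {i. i < length js \<and> js ! i = 1}"
            using kc tail k len by auto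
          then have "card (insert k {d - c..<d}) \<le> count (mset js) 1"
            unfolding count_mset_eq_card by (intro card_mono) auto
          then have "c < count (mset js) 1" using kc cd by simp
          moreover have "count (mset js) 1 \<le> d"
            using count_le_size[of "mset js" 1] len by simp
          ultimately have "D js = 0" using js by (intro less.hyps) (auto simp: c_def)
          then show ?thesis by simp
        qed
      qed
    qed (use b in auto)
    also have "\<dots> = D b"
    proof -
      have "(\<Prod>k<d. Tup (b ! k) (b ! k)) = 1" by (rule prod.neutral) (auto simp: Tup_def)
      then show ?thesis by simp
    qed
    also have "D b = D is"
      by (rule Dsym[OF b less.prems], rule mset_idx_eq[OF b less.prems]) (simp add: b_def c_def)
    finally show ?case .
  qed
  moreover have "A is = B is" if "is \<notin> idx d" for "is"
    using A B that by (simp add: Sym_def)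
  ultimately show "A is = B is" for "is"
    by (cases "is \<in> idx d") (auto simp: D_def)
qed

definition node_vec :: "nat \<Rightarrow> real \<Rightarrow> real \<Rightarrow> real \<times> real" where
  "node_vec d l x = (root d l * (1 - x), root d l * x)"

lemma tsum_node_vecs:
  assumes A: "A \<in> Sym d" and d: "d > 0"
    and lam: "\<And>i. i < r \<Longrightarrow> lam ! i > 0"
    and y: "\<And>k. k \<le> d \<Longrightarrow> Bvec d (LT Tup d A) k = (\<Sum>i<r. lam ! i * (xs ! i) ^ k)"
  shows "A = tsum d (map (\<lambda>i. node_vec d (lam ! i) (xs ! i)) [0..<r])"
proof (rule Sym_eqI[OF A tsum_in_Sym])
  fix k assume k: "k \<le> d"
  have *: "root d (lam ! i) ^ (d - k) * (root d (lam ! i) * xs ! i) ^ k = lam ! i * xs ! i ^ k" if "i < r" for i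
  proof -
    have "root d (lam ! i) ^ (d - k) * root d (lam ! i) ^ k = lam ! i"
      using lam[OF that] d k by (simp add: power_add[symmetric])
    then show ?thesis by (simp add: power_mult_distrib mult.assoc[symmetric])
  qed
  have "Bvec d (LT Tup d (tsum d (map (\<lambda>i. node_vec d (lam ! i) (xs ! i)) [0..<r]))) k
      = (\<Sum>i<r. root d (lam ! i) ^ (d - k) * (root d (lam ! i) * xs ! i) ^ k)"
    by (simp add: Bvec_LT_tsum[OF k] node_vec_def interv_sum_list_conv_sum_set_nat atLeast0LessThan
        o_def algebra_simps flip: distrib_left)
  also have "\<dots> = (\<Sum>i<r. lam ! i * xs ! i ^ k)"
    by (rule sum.cong) (use * in auto)
  finally show "Bvec d (LT Tup d A) k
      = Bvec d (LT Tup d (tsum d (map (\<lambda>i. node_vec d (lam ! i) (xs ! i)) [0..<r]))) k"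
    using y[OF k] by simp
qed

lemma nonneg2_node_vec: "x \<in> {0..1} \<Longrightarrow> l > 0 \<Longrightarrow> nonneg2 (node_vec d l x)"
  by (cases "d = 0") (auto simp: nonneg2_def node_vec_def real_root_ge_zero less_imp_le)

lemma cp_decomp_of_atomic_rep:
  assumes A: "A \<in> Sym d" and d: "d > 0"
    and rep: "atomic_rep d (Bvec d (LT Tup d A)) X c" and X: "X \<subseteq> {0..1}"
  shows "cp_decomp d A (map (\<lambda>x. node_vec d (c x) x) (sorted_list_of_set X))"
proof -
  define xs where "xs = sorted_list_of_set X"
  have fin: "finite X" using rep by (simp add: atomic_rep_def)
  then have xs: "set xs = X" "distinct xs" by (simp_all add: xs_def)
  have "A = tsum d (map (\<lambda>i. node_vec d (map c xs ! i) (xs ! i)) [0..<length xs])"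
  proof (rule tsum_node_vecs[OF A d])
    show "map c xs ! i > 0" if "i < length xs" for i
      using rep xs that nth_mem[of i xs] by (auto simp: atomic_rep_def)
    fix k assume "k \<le> d"
    then have "Bvec d (LT Tup d A) k = (\<Sum>x\<in>set xs. c x * x ^ k)"
      using rep xs by (simp add: atomic_rep_def)
    also have "\<dots> = (\<Sum>i<length xs. c (xs ! i) * (xs ! i) ^ k)"
      using sum.reindex_bij_betw[OF bij_betw_nth[OF xs(2) refl refl], of "\<lambda>x. c x * x ^ k"] by simp
    finally show "Bvec d (LT Tup d A) k = (\<Sum>i<length xs. map c xs ! i * (xs ! i) ^ k)" by simp
  qed
  also have "map (\<lambda>i. node_vec d (map c xs ! i) (xs ! i)) [0..<length xs] = map (\<lambda>x. node_vec d (c x) x) xs"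
    by (rule nth_equalityI) auto
  finally have "A = tsum d (map (\<lambda>x. node_vec d (c x) x) xs)" .
  moreover have "nonneg2 (node_vec d (c x) x)" if "x \<in> set xs" for x
    using that rep X xs by (intro nonneg2_node_vec) (auto simp: atomic_rep_def)
  ultimately show ?thesis by (auto simp: cp_decomp_def xs_def)
qed

text \<open>Conversely, a summand (a, b) of total mass a + b > 0 becomes an atom at b / (a + b); summands
  with the same direction merge into one atom and zero summands disappear.\<close>

lemma atomic_rep_of_cp_decomp:
  assumes cp: "cp_decomp d A vs" and d: "d > 0"
  obtains X c where "atomic_rep d (Bvec d (LT Tup d A)) X c" "X \<subseteq> {0..1}" "card X \<le> length vs"
    "card X = length vs \<Longrightarrow> mset vs = image_mset (\<lambda>x. node_vec d (c x) x) (mset_set X)"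
proof -
  define I where "I = {i. i < length vs \<and> vs ! i \<noteq> (0, 0)}"
  define f where "f i = snd (vs ! i) / (fst (vs ! i) + snd (vs ! i))" for i
  define g where "g i = (fst (vs ! i) + snd (vs ! i)) ^ d" for i
  define X where "X = f ` I"
  define c where "c x = (\<Sum>i\<in>{i \<in> I. f i = x}. g i)" for x
  have fin: "finite I" by (simp add: I_def)
  have nn: "fst (vs ! i) \<ge> 0" "snd (vs ! i) \<ge> 0" if "i < length vs" for i
    using cp that nth_mem[of i vs] by (auto simp: cp_decomp_def nonneg2_def)
  have pos: "fst (vs ! i) + snd (vs ! i) > 0" if "i \<in> I" for i
    using nn[of i] that unfolding I_def by (auto simp: prod_eq_iff order_less_le add_nonneg_eq_0_iff)
  have gpos: "g i > 0" if "i \<in> I" for i using pos[OF that] by (simp add: g_def)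
  have vec: "vs ! i = node_vec d (g i) (f i)" if "i \<in> I" for i
  proof -
    have "root d (g i) = fst (vs ! i) + snd (vs ! i)"
      using pos[OF that] d by (simp add: g_def real_root_power_cancel less_imp_le)
    then show ?thesis using pos[OF that] by (simp add: node_vec_def f_def prod_eq_iff field_simps)
  qed
  have "atomic_rep d (Bvec d (LT Tup d A)) X c"
    unfolding atomic_rep_def
  proof (intro conjI ballI allI impI)
    show "finite X" using fin by (simp add: X_def)
    show "c x > 0" if "x \<in> X" for x
      using that fin gpos unfolding c_def X_def by (intro sum_pos) auto
    fix k assume k: "k \<le> d"
    have "Bvec d (LT Tup d A) k = (\<Sum>v\<leftarrow>vs. (fst v + snd v) ^ (d - k) * snd v ^ k)"
      using cp Bvec_LT_tsum[OF k] by (simp add: cp_decomp_def)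
    also have "\<dots> = (\<Sum>i<length vs. (fst (vs ! i) + snd (vs ! i)) ^ (d - k) * snd (vs ! i) ^ k)"
      by (simp add: sum_list_sum_nth atLeast0LessThan)
    also have "\<dots> = (\<Sum>i\<in>I. (fst (vs ! i) + snd (vs ! i)) ^ (d - k) * snd (vs ! i) ^ k)"
    proof (rule sum.mono_neutral_right)
      \<comment> \<open>A zero summand contributes 0^(d - k) * 0^k, which is 0 because d > 0 makes
        one exponent positive.\<close>
      show "\<forall>i\<in>{..<length vs} - I. (fst (vs ! i) + snd (vs ! i)) ^ (d - k) * snd (vs ! i) ^ k = 0"
        using d k by (auto simp: I_def)
    qed (auto simp: I_def)
    also have "\<dots> = (\<Sum>i\<in>I. g i * f i ^ k)"
    proof (rule sum.cong[OF refl])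
      fix i assume "i \<in> I"
      have "(fst (vs ! i) + snd (vs ! i)) ^ d = (fst (vs ! i) + snd (vs ! i)) ^ (d - k) * (fst (vs ! i) + snd (vs ! i)) ^ k"
        using k by (simp add: power_add[symmetric])
      then show "(fst (vs ! i) + snd (vs ! i)) ^ (d - k) * snd (vs ! i) ^ k = g i * f i ^ k"
        using pos[OF \<open>i \<in> I\<close>] by (simp add: g_def f_def power_divide)
    qed
    also have "\<dots> = (\<Sum>x\<in>X. \<Sum>i\<in>{i \<in> I. f i = x}. g i * f i ^ k)"
      unfolding X_def by (rule sum.image_gen[OF fin])
    also have "\<dots> = (\<Sum>x\<in>X. c x * x ^ k)"
      by (rule sum.cong) (auto simp: c_def sum_distrib_right)
    finally show "Bvec d (LT Tup d A) k = (\<Sum>x\<in>X. c x * x ^ k)" .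
  qed
  moreover have "X \<subseteq> {0..1}"
    using nn pos by (auto simp: X_def f_def I_def)
  moreover have "card I \<le> length vs"
    unfolding I_def using card_mono[of "{..<length vs}" "{i. i < length vs \<and> vs ! i \<noteq> (0, 0)}"] by auto
  moreover have XI: "card X \<le> card I"
    unfolding X_def by (rule card_image_le[OF fin])
  \<comment> \<open>Equal cardinality leaves no room for zero or parallel summands: every index lies
    in I and f is injective, so each atom comes from exactly one summand.\<close>
  moreover have "mset vs = image_mset (\<lambda>x. node_vec d (c x) x) (mset_set X)" if "card X = length vs"
  proof -
    have "card I = card {..<length vs}" using that \<open>card I \<le> length vs\<close> XI by simp
    then have I: "I = {..<length vs}"
      by (intro card_subset_eq) (auto simp: I_def)
    have inj: "inj_on f I"
      by (rule eq_card_imp_inj_on[OF fin]) (use that I in \<open>simp add: X_def\<close>)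
    have c: "c (f i) = g i" if "i \<in> I" for i
    proof -
      have "{j \<in> I. f j = f i} = {i}" using that inj by (auto simp: inj_on_def)
      then show ?thesis by (simp add: c_def)
    qed
    have "mset_set X = image_mset f (mset_set I)"
      unfolding X_def using inj by (simp add: image_mset_mset_set)
    then have "image_mset (\<lambda>x. node_vec d (c x) x) (mset_set X)
        = image_mset (\<lambda>i. node_vec d (c (f i)) (f i)) (mset_set I)"
      by (simp add: image_mset.compositionality o_def)
    also have "\<dots> = image_mset (\<lambda>i. vs ! i) (mset_set I)"
      by (rule image_mset_cong) (use fin c vec in auto)
    also have "\<dots> = mset (map (\<lambda>i. vs ! i) [0..<length vs])"
      by (simp add: I atLeast0LessThan[symmetric] mset_upt[symmetric] del: mset_upt)
    also have "\<dots> = mset vs" by (simp add: map_nth)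
    finally show ?thesis by simp
  qed
  ultimately show ?thesis using that by (meson order_trans)
qed

section \<open>Completely positive tensors\<close>

lemma truncated_hausdorff_if_psd:
  assumes psd1: "psd (H1 s y)" and psd2: "psd (H2 s y)" and y0: "y 0 > 0"
  shows "truncated_hausdorff s y"
proof
  fix h :: "real poly"
  show "riesz y (h * h) \<ge> 0" if "degree h \<le> s"
    using riesz_square_nonneg_if_psd[of "s + 1" y h] psd1 that by (simp add: H1_def)
  show "riesz y ([:0, 1, -1:] * (h * h)) \<ge> 0" if "degree h < s"
  proof -
    have *: "riesz y ([:0, 1, -1:] * monom 1 k) = y (k + 1) - y (k + 2)" for k
      by (simp add: riesz_pCons riesz_add riesz_minus riesz_monom)
    have "H2 s y = mat s s (\<lambda>(i,j). riesz y ([:0, 1, -1:] * monom 1 (i + j)))"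
      unfolding * by (simp add: H2_def)
    then have "riesz (\<lambda>k. riesz y ([:0, 1, -1:] * monom 1 k)) (h * h) \<ge> 0"
      using psd2 that by (intro riesz_square_nonneg_if_psd[of s]) auto
    then show ?thesis by (simp only: riesz_weight)
  qed
qed (rule y0)

text \<open>The 2r unknown nodes and weights face K + r + 1 >= 2r moments. The linear system fixes
  the node polynomial, and the nodes then fix the weights.\<close>

lemma atomic_rep_unique:
  assumes rep: "atomic_rep (K + r) y X c" "atomic_rep (K + r) y X' c'"
    and card: "card X = r" "card X' = r" and r: "r > 0" "r \<le> K + 1"
  shows "X = X'" "\<And>x. x \<in> X \<Longrightarrow> c x = c' x"
proof -
  have fin: "finite X" "finite X'" using rep by (auto simp: atomic_rep_def)
  have "map (\<lambda>j. - coeff (node_poly X) j) [0..<r] = map (\<lambda>j. - coeff (node_poly X') j) [0..<r]"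
    using node_poly_linear_system[OF rep(1) card(1) r] node_poly_linear_system[OF rep(2) card(2) r]
    by blast
  then have "node_poly X = node_poly X'"
    using node_poly_eq_sum_monom[OF card(1) refl] node_poly_eq_sum_monom[OF card(2) refl]
    by (metis minus_minus)
  then show XX: "X = X'"
    using poly_node_poly_eq_0_iff[OF fin(1)] poly_node_poly_eq_0_iff[OF fin(2)] by auto
  show "c x = c' x" if "x \<in> X" for x
  proof (rule quadrature_weights_unique[where c = c and c' = c' and X = X and D = "K + r"])
    show "(\<Sum>x\<in>X. c x * x ^ k) = (\<Sum>x\<in>X. c' x * x ^ k)" if "k \<le> K + r" for k
      using rep XX that by (simp add: atomic_rep_def)
  qed (use that fin card r in auto)
qed

lemma sum_nth_eq_sum_set:
  assumes "distinct xs" "length xs = r"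
  shows "(\<Sum>i<r. f (xs ! i)) = (\<Sum>x\<in>set xs. f x)"
  using sum.reindex_bij_betw[OF bij_betw_nth[OF assms(1) refl refl], of f] assms(2) by simp

lemma list_weights_unique:
  fixes xs lam lam' :: "real list"
  assumes xs: "distinct xs" "length xs = r" "r \<le> D + 1"
    and lam: "length lam = r" "length lam' = r"
    and eq: "\<And>k. k \<le> D \<Longrightarrow> (\<Sum>i<r. lam ! i * (xs ! i) ^ k) = (\<Sum>i<r. lam' ! i * (xs ! i) ^ k)"
  shows "lam = lam'"
proof (rule nth_equalityI)
  define w where "w ls x = the (map_of (zip xs ls) x)" for ls :: "real list" and x
  have w: "w ls (xs ! i) = ls ! i" if "length ls = r" "i < r" for ls :: "real list" and i
    using map_of_zip_nth[of xs ls i] xs that by (simp add: w_def)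
  have *: "(\<Sum>i<r. ls ! i * (xs ! i) ^ k) = (\<Sum>x\<in>set xs. w ls x * x ^ k)" if "length ls = r" for ls :: "real list" and k
  proof -
    have "(\<Sum>i<r. ls ! i * (xs ! i) ^ k) = (\<Sum>i<r. w ls (xs ! i) * (xs ! i) ^ k)"
      using w[OF that] by simp
    also have "\<dots> = (\<Sum>x\<in>set xs. w ls x * x ^ k)"
      by (rule sum_nth_eq_sum_set[OF xs(1,2)])
    finally show ?thesis .
  qed
  show "lam ! i = lam' ! i" if "i < length lam" for i
  proof -
    have "w lam (xs ! i) = w lam' (xs ! i)"
    proof (rule quadrature_weights_unique[where c = "w lam" and c' = "w lam'" and X = "set xs" and D = D])
      show "(\<Sum>x\<in>set xs. w lam x * x ^ k) = (\<Sum>x\<in>set xs. w lam' x * x ^ k)" if "k \<le> D" for k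
        using eq[OF that] *[OF lam(1), of k] *[OF lam(2), of k] by simp
    qed (use xs that lam distinct_card[OF xs(1)] in auto)
    then show ?thesis using w lam that by simp
  qed
qed (simp add: lam)

text \<open>The case split is on a zero of the quadratic form; the rank is read off later from the
  number of nodes by \<open>mrank_atomic_hankel\<close>.\<close>

lemma (in truncated_hausdorff) exists_atomic_rep:
  assumes "s > 0"
  obtains X c where "atomic_rep (2 * s) y X c" "X \<subseteq> {0..1}" "card X \<le> s + 1"
proof (cases "\<exists>p. p \<noteq> 0 \<and> degree p \<le> s \<and> riesz y (p * p) = 0")
  case True
  then obtain p where "p \<noteq> 0" "degree p \<le> s" "riesz y (p * p) = 0" by blast
  from singular_representation[OF this] obtain X c
    where "atomic_rep (2 * s) y X c" "X \<subseteq> {0..1}" "card X \<le> s" by blast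
  then show ?thesis using that[of X c] by simp
next
  case False
  interpret truncated_hausdorff_pos s y
  proof unfold_locales
    show "riesz y (h * h) > 0" if "h \<noteq> 0" "degree h \<le> s" for h
      using square_nonneg[OF that(2)] False that by (auto simp: order_less_le)
  qed (rule assms)
  show ?thesis
    using principal_representation(1)[of "[:0, 1:]", OF _ refl refl] that
    by (auto simp: end_weight_def)
qed

text \<open>For the weight x the moments y_(k+1) give \<open>M\<close> and \<open>z\<close>; for 1 -
  x the moments y_k - y_(k+1) give \<open>N\<close> and \<open>w\<close>. In the second case the top
  weighted moment is y_(2s) minus the moment of order 2s + 1, so its lower bound turns into the
  upper bound u.\<close>

lemma (in truncated_hausdorff_pos) endpoint_moment_bounds:
  fixes M N :: "real mat" and z w :: "real vec"
  assumes zdef: "z = vec s (\<lambda>i. y (s + 1 + i))"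
    and Mdef: "M = mat s s (\<lambda>(i,j). y (i+j+1))"
    and wdef: "w = vec s (\<lambda>i. y (s + i) - y (s + i + 1))"
    and Ndef: "N = mat s s (\<lambda>(i,j). y (i+j) - y (i+j+1))"
    and ldef: "l = scalar_prod z (pinv M *\<^sub>v z)"
    and udef: "u = y (2 * s) - (scalar_prod w (pinv N *\<^sub>v w))"
  shows "\<exists>X c. atomic_rep (2 * s) y X c \<and> X \<subseteq> {0..1} \<and> card X = s + 1 \<and>
      (\<Sum>x\<in>X. c x * x ^ (2 * s + 1)) = l"
    and "\<exists>X c. atomic_rep (2 * s) y X c \<and> X \<subseteq> {0..1} \<and> card X = s + 1 \<and>
      (\<Sum>x\<in>X. c x * x ^ (2 * s + 1)) = u"
    and "\<And>X c. atomic_rep (2 * s) y X c \<Longrightarrow> X \<subseteq> {0..1} \<Longrightarrow>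
      l \<le> (\<Sum>x\<in>X. c x * x ^ (2 * s + 1)) \<and> (\<Sum>x\<in>X. c x * x ^ (2 * s + 1)) \<le> u"
proof -
  have lo: "riesz y ([:0, 1:] * monom 1 k) = y (k + 1)" for k
    by (simp add: riesz_pCons riesz_monom)
  have hi: "riesz y ([:1, -1:] * monom 1 k) = y k - y (k + 1)" for k
    by (simp add: riesz_pCons riesz_add riesz_minus riesz_monom)
  have w: "end_weight [:0, 1:]" "end_weight [:1, -1:]" by (auto simp: end_weight_def)
  note L = principal_representation[OF w(1), of M z, unfolded lo]
  note U = principal_representation[OF w(2), of N w, unfolded hi]
  have sum_hi: "(\<Sum>x\<in>X. c x * (poly [:1, -1:] x * x ^ (2 * s)))
      = y (2 * s) - (\<Sum>x\<in>X. c x * x ^ (2 * s + 1))" if "atomic_rep (2 * s) y X c" for X c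
    using that by (simp add: atomic_rep_def algebra_simps sum_subtractf)
  have sum_lo: "(\<Sum>x\<in>X. c x * (poly [:0, 1:] x * x ^ (2 * s))) = (\<Sum>x\<in>X. c x * x ^ (2 * s + 1))"
    for X :: "real set" and c by simp
  have M: "M = mat s s (\<lambda>(i,j). y (i + j + 1))" and z: "z = vec s (\<lambda>i. y (s + i + 1))"
    by (simp_all add: Mdef zdef)
  show "\<exists>X c. atomic_rep (2 * s) y X c \<and> X \<subseteq> {0..1} \<and> card X = s + 1 \<and>
      (\<Sum>x\<in>X. c x * x ^ (2 * s + 1)) = l"
    using L(1)[OF M z] unfolding sum_lo ldef .
  obtain X c where "atomic_rep (2 * s) y X c \<and> X \<subseteq> {0..1} \<and> card X = s + 1 \<and>
      (\<Sum>x\<in>X. c x * (poly [:1, -1:] x * x ^ (2 * s))) = scalar_prod w (pinv N *\<^sub>v w)"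
    using U(1)[OF Ndef wdef] by blast
  then have "atomic_rep (2 * s) y X c \<and> X \<subseteq> {0..1} \<and> card X = s + 1 \<and>
      (\<Sum>x\<in>X. c x * x ^ (2 * s + 1)) = u"
    using sum_hi[of X c] by (simp add: udef)
  then show "\<exists>X c. atomic_rep (2 * s) y X c \<and> X \<subseteq> {0..1} \<and> card X = s + 1 \<and>
      (\<Sum>x\<in>X. c x * x ^ (2 * s + 1)) = u" by blast
  show "l \<le> (\<Sum>x\<in>X. c x * x ^ (2 * s + 1)) \<and> (\<Sum>x\<in>X. c x * x ^ (2 * s + 1)) \<le> u"
    if rep: "atomic_rep (2 * s) y X c" "X \<subseteq> {0..1}" for X c
    using L(2)[OF M z rep] U(2)[OF Ndef wdef rep] unfolding sum_lo sum_hi[OF rep(1)] ldef udef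
    by linarith
qed

text \<open>A shorter decomposition would give a representation with fewer atoms, yet both atom
  counts equal the rank of H_1.\<close>

lemma cp_rank_eq_card:
  assumes A: "A \<in> Sym (2 * s)" and s: "s > 0"
    and rep: "atomic_rep (2 * s) (Bvec (2 * s) (LT Tup (2 * s) A)) X c"
    and X: "X \<subseteq> {0..1}" "card X \<le> s + 1"
  shows "cp_rank (2 * s) A = card X"
  unfolding cp_rank_def
proof (rule Least_equality)
  define y where "y = Bvec (2 * s) (LT Tup (2 * s) A)"
  show "\<exists>vs. length vs = card X \<and> cp_decomp (2 * s) A vs"
    using cp_decomp_of_atomic_rep[OF A _ rep X(1)] s
    by (intro exI[of _ "map (\<lambda>x. node_vec (2 * s) (c x) x) (sorted_list_of_set X)"]) simp
  fix m assume "\<exists>vs. length vs = m \<and> cp_decomp (2 * s) A vs"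
  then obtain vs where vs: "length vs = m" "cp_decomp (2 * s) A vs" by blast
  obtain X' c' where X': "atomic_rep (2 * s) y X' c'" "card X' \<le> length vs"
    using atomic_rep_of_cp_decomp[OF vs(2)] s unfolding y_def by (metis mult_pos_pos zero_less_numeral)
  show "card X \<le> m"
  proof (rule ccontr)
    assume "\<not> card X \<le> m"
    then have "card X' \<le> s + 1" using X' vs X(2) by simp
    then have "card X' = card X"
      using mrank_atomic_hankel[OF X'(1)] mrank_atomic_hankel[OF rep X(2)] by (simp add: y_def)
    then show False using X'(2) vs \<open>\<not> card X \<le> m\<close> by simp
  qed
qed

text \<open>By the same rank count a shortest decomposition has as many atoms as summands, so
  nothing merges and it can be recovered from its measure.\<close>

lemma mset_cp_decomp_of_length_cp_rank:
  assumes A: "A \<in> Sym (2 * s)" and s: "s > 0"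
    and rep: "atomic_rep (2 * s) (Bvec (2 * s) (LT Tup (2 * s) A)) X c"
    and X: "X \<subseteq> {0..1}" "card X \<le> s + 1"
    and vs: "cp_decomp (2 * s) A vs" "length vs = card X"
  obtains X' c' where "atomic_rep (2 * s) (Bvec (2 * s) (LT Tup (2 * s) A)) X' c'" "X' \<subseteq> {0..1}"
    "card X' = card X" "mset vs = image_mset (\<lambda>x. node_vec (2 * s) (c' x) x) (mset_set X')"
proof -
  have d: "2 * s > 0" using s by simp
  obtain X' c' where X': "atomic_rep (2 * s) (Bvec (2 * s) (LT Tup (2 * s) A)) X' c'" "X' \<subseteq> {0..1}"
    "card X' \<le> length vs"
    "card X' = length vs \<Longrightarrow> mset vs = image_mset (\<lambda>x. node_vec (2 * s) (c' x) x) (mset_set X')"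
    using atomic_rep_of_cp_decomp[OF vs(1) d] by blast
  then have "card X' = card X"
    using mrank_atomic_hankel[OF X'(1)] mrank_atomic_hankel[OF rep X(2)] vs X(2) by simp
  then show ?thesis using X' vs that by simp
qed

text \<open>The multiset of vectors determines all moments, including order 2s + 1 > d, so
  decompositions with different such moments differ. The quotient is used because k may exceed
  d.\<close>

lemma moment_of_node_vecs:
  assumes rep: "atomic_rep D y X c" and d: "d > 0"
  shows "(\<Sum>v\<in>#image_mset (\<lambda>x. node_vec d (c x) x) (mset_set X).
      (fst v + snd v) ^ d * (snd v / (fst v + snd v)) ^ k) = (\<Sum>x\<in>X. c x * x ^ k)"
proof -
  have "(fst v + snd v) ^ d * (snd v / (fst v + snd v)) ^ k = c x * x ^ k"
    if "x \<in> X" "v = node_vec d (c x) x" for x v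
  proof -
    have c: "c x > 0" using rep that by (simp add: atomic_rep_def)
    have "fst v + snd v = root d (c x)" by (simp add: that node_vec_def algebra_simps)
    moreover have "root d (c x) > 0" using c d by (simp add: real_root_gt_zero)
    ultimately show ?thesis using c d that by (simp add: node_vec_def)
  qed
  then have "(\<Sum>x\<in>X. (fst (node_vec d (c x) x) + snd (node_vec d (c x) x)) ^ d *
      (snd (node_vec d (c x) x) / (fst (node_vec d (c x) x) + snd (node_vec d (c x) x))) ^ k)
      = (\<Sum>x\<in>X. c x * x ^ k)"
    by (intro sum.cong) blast+
  then show ?thesis
    by (simp add: image_mset.compositionality o_def sum_unfold_sum_mset)
qed

theorem theorem3p4:
  fixes s d :: nat and A :: tensor and y :: "nat \<Rightarrow> real"
    and r :: nat and l u :: real and M N :: "real mat" and z w :: "real vec"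
  assumes s1: "s \<ge> 1" and dd: "d = 2 * s"
    and AS: "A \<in> Sym d"
    and ydef: "y = Bvec d (LT Tup d A)"
    and psd1: "psd (H1 s y)" and psd2: "psd (H2 s y)" and y0: "y 0 > 0"
    and rdef: "r = mrank (H1 s y)"
    and zdef: "z = vec s (\<lambda>i. y (s + 1 + i))"
    and Mdef: "M = mat s s (\<lambda>(i,j). y (i+j+1))"
    and wdef: "w = vec s (\<lambda>i. y (s + i) - y (s + i + 1))"
    and Ndef: "N = mat s s (\<lambda>(i,j). y (i+j) - y (i+j+1))"
    and ldef: "l = scalar_prod z (pinv M *\<^sub>v z)"
    and udef: "u = y (2 * s) - (scalar_prod w (pinv N *\<^sub>v w))"
  shows
    "r \<le> s + 1 \<and>
     \<comment> \<open>(i)\<close>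
     (r \<le> s \<longrightarrow> (\<exists>!g. length g = r \<and>
        (\<forall>i\<le>2 * s - r. (\<Sum>j<r. y (i+j) * g ! j) = y (i+r)))) \<and>
     (r = s + 1 \<longrightarrow> (let y' = y(2 * s+1 := l) in (\<exists>!g. length g = s + 1 \<and>
        (\<forall>i\<le>s. (\<Sum>j\<le>s. y' (i+j) * g ! j) = y' (i+s+1))))) \<and>
     \<comment> \<open>(ii)\<close>
     (let y' = (if r \<le> s then y else y(2 * s+1 := l));
          g = (THE g. length g = r \<and>
                 (\<forall>i\<le>(if r \<le> s then 2 * s - r else s).
                    (\<Sum>j<r. y' (i+j) * g ! j) = y' (i+r)));
          p = (\<Sum>j<r. monom (g ! j) j) - monom 1 r;
          roots = {x. poly p x = 0};
          xs = sorted_list_of_set roots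
      in finite roots \<and> card roots = r \<and> roots \<subseteq> {0..1} \<and>
         (\<exists>!lam. length lam = r \<and> (\<forall>i<r. lam ! i > 0) \<and>
              (\<forall>k\<le>d. y k = (\<Sum>i<r. lam ! i * (xs ! i) ^ k))) \<and>
         (\<forall>lam. length lam = r \<and> (\<forall>i<r. lam ! i > 0) \<and>
              (\<forall>k\<le>d. y k = (\<Sum>i<r. lam ! i * (xs ! i) ^ k)) \<longrightarrow>
            (let ab = map (\<lambda>i. (root d (lam ! i) * (1 - xs ! i), root d (lam ! i) * xs ! i)) [0..<r]
             in A = tsum d ab \<and> (\<forall>v\<in>set ab. nonneg2 v)))) \<and>
     \<comment> \<open>(iii)\<close>
     (r \<le> s \<longrightarrow> (\<exists>!\<mu>. rep_measure d y \<mu>)) \<and>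
     (r = s + 1 \<longrightarrow> ((\<exists>!\<mu>. rep_measure d y \<mu> \<and> atomic r \<mu> \<and> msupport \<mu> \<subseteq> {0..1}) \<longleftrightarrow> l = u)) \<and>
     \<comment> \<open>(iv)\<close>
     cp_rank d A = r \<and>
     (r \<le> s \<longrightarrow> unique_cp_rank_decomp d A) \<and>
     (r = s + 1 \<longrightarrow> (unique_cp_rank_decomp d A \<longleftrightarrow> l = u))"
proof -
  have s: "s > 0" using s1 by simp
  have d0: "d > 0" using s dd by simp
  interpret truncated_hausdorff s y
    using truncated_hausdorff_if_psd psd1 psd2 y0 by blast
  obtain X0 c0 where X0: "atomic_rep (2 * s) y X0 c0" "X0 \<subseteq> {0..1}" "card X0 \<le> s + 1"
    using exists_atomic_rep[OF s] by blast
  have r0: "r = card X0" using mrank_atomic_hankel[OF X0(1,3)] rdef by simp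
  have rs: "r \<le> s + 1" using X0(3) r0 by simp
  have rpos: "r > 0"
  proof -
    have "X0 \<noteq> {}" using X0(1) y0 by (auto simp: atomic_rep_def)
    then show ?thesis using X0(1) r0 by (auto simp: atomic_rep_def card_gt_0_iff)
  qed
  have pos: "truncated_hausdorff_pos s y" if "r = s + 1"
  proof
    show "riesz y (h * h) > 0" if "h \<noteq> 0" "degree h \<le> s" for h
      using riesz_square_pos_of_atomic_rep[OF X0(1) that(1)] that r0 \<open>r = s + 1\<close> by simp
  qed (rule s)
  note bounds = truncated_hausdorff_pos.endpoint_moment_bounds[OF pos zdef Mdef wdef Ndef ldef udef]
  \<comment> \<open>Both cases as one system: K + r is 2s for r <= s and 2s + 1 for r = s + 1, where
    \<open>y'\<close> also prescribes the extra moment l.\<close>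
  define y' where "y' = (if r \<le> s then y else y(2 * s + 1 := l))"
  define K where "K = (if r \<le> s then 2 * s - r else s)"
  have rK: "r \<le> K + 1" using rs by (simp add: K_def) arith
  have extend: "atomic_rep (K + r) y' X c \<longleftrightarrow>
      atomic_rep (2 * s) y X c \<and> (r = s + 1 \<longrightarrow> (\<Sum>x\<in>X. c x * x ^ (2 * s + 1)) = l)" for X c
  proof (cases "r \<le> s")
    case True
    then show ?thesis by (simp add: K_def y'_def)
  next
    case False
    then have "r = s + 1" using rs by simp
    moreover have "K + r = Suc (2 * s)" "y' = y(Suc (2 * s) := l)"
      using \<open>r = s + 1\<close> by (simp_all add: K_def y'_def)
    ultimately show ?thesis
      by (auto simp: atomic_rep_def le_Suc_eq mult_2)
  qed
  \<comment> \<open>For r = s + 1 the atoms of X0 may have another moment of order 2s + 1; the lower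
    principal representation has the value l.\<close>
  obtain X c where rep': "atomic_rep (K + r) y' X c" and unit: "X \<subseteq> {0..1}" and card: "card X = r"
  proof (cases "r \<le> s")
    case True
    then show ?thesis using X0 r0 extend[of X0 c0] that by simp
  next
    case False
    then have "r = s + 1" using rs by simp
    then show ?thesis using bounds(1) extend that by blast
  qed
  have rep: "atomic_rep (2 * s) y X c" using rep' extend by blast
  have repd: "atomic_rep d (Bvec d (LT Tup d A)) X c" using rep dd ydef by simp
  have fin: "finite X" using rep by (simp add: atomic_rep_def)
  \<comment> \<open>If l = u, the bounds force the moment of order 2s + 1 to be l, so every
    competitor also represents \<open>y'\<close>.\<close>
  have unique: "X' = X \<and> (\<forall>x\<in>X. c' x = c x)"
    if "atomic_rep (2 * s) y X' c'" "X' \<subseteq> {0..1}" "card X' = r" "r = s + 1 \<longrightarrow> l = u" for X' c'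
  proof -
    have "atomic_rep (K + r) y' X' c'"
      using bounds(3)[OF _ that(1,2)] that extend by force
    from atomic_rep_unique[OF rep' this card that(3) rpos rK] show ?thesis by auto
  qed
  have nonunique: "\<exists>X' c'. atomic_rep (2 * s) y X' c' \<and> X' \<subseteq> {0..1} \<and> card X' = r \<and>
      (\<Sum>x\<in>X'. c' x * x ^ (2 * s + 1)) = u" if "r = s + 1"
    using bounds(2) that by simp
  have low: "(\<Sum>x\<in>X. c x * x ^ (2 * s + 1)) = l" if "r = s + 1"
    using rep' extend that by blast

  \<comment> \<open>(i): the linear systems\<close>
  define g where "g = map (\<lambda>j. - coeff (node_poly X) j) [0..<r]"
  have system: "length h = r \<and> (\<forall>i\<le>K. (\<Sum>j<r. y' (i + j) * h ! j) = y' (i + r)) \<longleftrightarrow> h = g" for h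
    unfolding g_def by (rule node_poly_linear_system[OF rep' card rpos rK])
  have i1: "\<exists>!g. length g = r \<and> (\<forall>i\<le>2 * s - r. (\<Sum>j<r. y (i+j) * g ! j) = y (i+r))"
    if "r \<le> s"
    using system that by (auto simp: K_def y'_def)
  have i2: "let y' = y(2 * s+1 := l) in (\<exists>!g. length g = s + 1 \<and>
        (\<forall>i\<le>s. (\<Sum>j\<le>s. y' (i+j) * g ! j) = y' (i+s+1)))" if "r = s + 1"
  proof -
    have "length h = s + 1 \<and> (\<forall>i\<le>s. (\<Sum>j\<le>s. y' (i + j) * h ! j) = y' (i + s + 1)) \<longleftrightarrow> h = g" for h
      using system[of h] that by (simp add: K_def lessThan_Suc_atMost)
    moreover have "y' = y(2 * s + 1 := l)" using that by (simp add: y'_def)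
    ultimately show ?thesis by (simp only: Let_def) blast
  qed

  \<comment> \<open>(ii): nodes, weights and the decomposition\<close>
  define xs where "xs = sorted_list_of_set X"
  have xs: "set xs = X" "distinct xs" "length xs = r"
    using fin card by (simp_all add: xs_def)
  have xs_nodes: "xs ! i \<in> X" if "i < r" for i
    using xs that nth_mem[of i xs] by simp
  have lam_sum: "y k = (\<Sum>i<r. map c xs ! i * (xs ! i) ^ k)" if "k \<le> d" for k
    using rep that dd xs sum_nth_eq_sum_set[OF xs(2,3), of "\<lambda>x. c x * x ^ k"]
    by (simp add: atomic_rep_def)
  have lam1: "\<exists>!lam. length lam = r \<and> (\<forall>i<r. lam ! i > 0) \<and>
              (\<forall>k\<le>d. y k = (\<Sum>i<r. lam ! i * (xs ! i) ^ k))"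
  proof (rule ex1I[of _ "map c xs"])
    show "length (map c xs) = r \<and> (\<forall>i<r. map c xs ! i > 0) \<and>
              (\<forall>k\<le>d. y k = (\<Sum>i<r. map c xs ! i * (xs ! i) ^ k))"
      using lam_sum xs xs_nodes rep by (simp add: atomic_rep_def)
    show "lam = map c xs" if "length lam = r \<and> (\<forall>i<r. lam ! i > 0) \<and>
              (\<forall>k\<le>d. y k = (\<Sum>i<r. lam ! i * (xs ! i) ^ k))" for lam
      by (rule list_weights_unique[OF xs(2,3), of d]) (use that lam_sum xs rs dd s in auto)
  qed
  have lam2: "let ab = map (\<lambda>i. (root d (lam ! i) * (1 - xs ! i), root d (lam ! i) * xs ! i)) [0..<r]
             in A = tsum d ab \<and> (\<forall>v\<in>set ab. nonneg2 v)"
    if "length lam = r \<and> (\<forall>i<r. lam ! i > 0) \<and>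
              (\<forall>k\<le>d. y k = (\<Sum>i<r. lam ! i * (xs ! i) ^ k))" for lam
  proof -
    have "A = tsum d (map (\<lambda>i. node_vec d (lam ! i) (xs ! i)) [0..<r])"
      by (rule tsum_node_vecs[OF AS d0]) (use that ydef in auto)
    moreover have "nonneg2 (node_vec d (lam ! i) (xs ! i))" if "i < r" for i
      using that \<open>length lam = r \<and> _\<close> xs_nodes[OF that] unit by (intro nonneg2_node_vec) auto
    ultimately show ?thesis by (auto simp: node_vec_def)
  qed
  have the_g: "(THE g. length g = r \<and> (\<forall>i\<le>K. (\<Sum>j<r. y' (i+j) * g ! j) = y' (i+r))) = g"
    unfolding system by simp
  have roots: "{x. poly ((\<Sum>j<r. monom (g ! j) j) - monom 1 r) x = 0} = X"
    using node_poly_eq_sum_monom[OF card g_def] poly_node_poly_eq_0_iff[OF fin] by simp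
  have ii: "let y' = (if r \<le> s then y else y(2 * s+1 := l));
          g = (THE g. length g = r \<and>
                 (\<forall>i\<le>(if r \<le> s then 2 * s - r else s).
                    (\<Sum>j<r. y' (i+j) * g ! j) = y' (i+r)));
          p = (\<Sum>j<r. monom (g ! j) j) - monom 1 r;
          roots = {x. poly p x = 0};
          xs = sorted_list_of_set roots
      in finite roots \<and> card roots = r \<and> roots \<subseteq> {0..1} \<and>
         (\<exists>!lam. length lam = r \<and> (\<forall>i<r. lam ! i > 0) \<and>
              (\<forall>k\<le>d. y k = (\<Sum>i<r. lam ! i * (xs ! i) ^ k))) \<and>
         (\<forall>lam. length lam = r \<and> (\<forall>i<r. lam ! i > 0) \<and>
              (\<forall>k\<le>d. y k = (\<Sum>i<r. lam ! i * (xs ! i) ^ k)) \<longrightarrow>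
            (let ab = map (\<lambda>i. (root d (lam ! i) * (1 - xs ! i), root d (lam ! i) * xs ! i)) [0..<r]
             in A = tsum d ab \<and> (\<forall>v\<in>set ab. nonneg2 v)))"
    unfolding y'_def[symmetric] K_def[symmetric] Let_def[of y'] the_g Let_def[of g]
      Let_def[of "(\<Sum>j<r. monom (g ! j) j) - monom 1 r"] roots Let_def[of X]
      xs_def[symmetric] Let_def[of xs]
    using fin card unit lam1 lam2 by blast

  \<comment> \<open>(iii): uniqueness of representing measures\<close>
  have repm: "rep_measure d y (atomic_measure X' c') \<and> atomic r (atomic_measure X' c') \<and>
      msupport (atomic_measure X' c') \<subseteq> {0..1}"
    if "atomic_rep (2 * s) y X' c'" "X' \<subseteq> {0..1}" "card X' = r" for X' c'
    using that rep_measure_atomic_measure[OF that(1)] msupport_atomic_measure[of X' c'] dd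
    by (simp add: atomic_def atomic_rep_def)
  have iii1: "\<exists>!\<mu>. rep_measure d y \<mu>" if "r \<le> s"
    using repm[OF rep unit card] rep_measure_unique[OF rep] card that dd by auto
  have iii2: "(\<exists>!\<mu>. rep_measure d y \<mu> \<and> atomic r \<mu> \<and> msupport \<mu> \<subseteq> {0..1}) \<longleftrightarrow> l = u"
    if r: "r = s + 1"
  proof
    assume ex1: "\<exists>!\<mu>. rep_measure d y \<mu> \<and> atomic r \<mu> \<and> msupport \<mu> \<subseteq> {0..1}"
    obtain X' c' where X': "atomic_rep (2 * s) y X' c'" "X' \<subseteq> {0..1}" "card X' = r"
      "(\<Sum>x\<in>X'. c' x * x ^ (2 * s + 1)) = u"
      using nonunique[OF r] by blast
    \<comment> \<open>The lower and upper principal measures coincide, hence so do their moments l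
      and u of order 2s + 1.\<close>
    have "atomic_measure X c = atomic_measure X' c'"
      using ex1 repm[OF rep unit card] repm[OF X'(1-3)] by blast
    from atomic_measure_inject[OF rep X'(1) this] show "l = u"
      using low[OF r] X'(4) by (metis (no_types, lifting) sum.cong)
  next
    assume lu: "l = u"
    show "\<exists>!\<mu>. rep_measure d y \<mu> \<and> atomic r \<mu> \<and> msupport \<mu> \<subseteq> {0..1}"
    proof (rule ex1I[of _ "atomic_measure X c"])
      show "rep_measure d y (atomic_measure X c) \<and> atomic r (atomic_measure X c) \<and>
          msupport (atomic_measure X c) \<subseteq> {0..1}"
        by (rule repm[OF rep unit card])
    next
      fix \<mu> assume \<mu>: "rep_measure d y \<mu> \<and> atomic r \<mu> \<and> msupport \<mu> \<subseteq> {0..1}"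
      then have fm: "finite (msupport \<mu>)" "card (msupport \<mu>) = r" by (auto simp: atomic_def)
      note supp = rep_measure_finite_support[OF conjunct1[OF \<mu>] fm(1)]
      have "msupport \<mu> = X \<and> (\<forall>x\<in>X. measure \<mu> {x} = c x)"
        using supp(2) \<mu> fm(2) lu dd by (intro unique) auto
      then show "\<mu> = atomic_measure X c"
        using supp(1) atomic_measure_cong[of X "\<lambda>x. measure \<mu> {x}" c] fin by metis
    qed
  qed

  \<comment> \<open>(iv): cp-rank and uniqueness of the decomposition\<close>
  have X_le: "card X \<le> s + 1" using card rs by simp
  note A' = AS[unfolded dd] s rep[unfolded ydef dd] unit X_le
  have cp: "cp_rank d A = r"
    using cp_rank_eq_card[OF A'] card dd by simp
  have mset_unique: "mset vs = image_mset (\<lambda>x. node_vec d (c x) x) (mset_set X)"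
    if "length vs = cp_rank d A" "cp_decomp d A vs" "r = s + 1 \<longrightarrow> l = u" for vs
  proof -
    have "cp_decomp (2 * s) A vs" "length vs = card X" using that cp card dd by simp_all
    from mset_cp_decomp_of_length_cp_rank[OF A' this] obtain X' c' where
      X': "atomic_rep (2 * s) y X' c'" "X' \<subseteq> {0..1}" "card X' = card X"
        "mset vs = image_mset (\<lambda>x. node_vec d (c' x) x) (mset_set X')"
      unfolding dd ydef by blast
    then have "X' = X \<and> (\<forall>x\<in>X. c' x = c x)" using unique card that by simp
    then show ?thesis using X'(4) fin by (auto intro!: image_mset_cong)
  qed
  then have iv1: "unique_cp_rank_decomp d A" if "r = s + 1 \<longrightarrow> l = u"
    using that unfolding unique_cp_rank_decomp_def by metis
  have iv2: "l = u" if r: "r = s + 1" and uniq: "unique_cp_rank_decomp d A"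
  proof -
    obtain X' c' where X': "atomic_rep (2 * s) y X' c'" "X' \<subseteq> {0..1}" "card X' = r"
      "(\<Sum>x\<in>X'. c' x * x ^ (2 * s + 1)) = u"
      using nonunique[OF r] by blast
    define vs where "vs X c = map (\<lambda>x. node_vec d (c x) x) (sorted_list_of_set X)"
      for X :: "real set" and c
    have "length (vs X c) = cp_rank d A" "length (vs X' c') = cp_rank d A"
      using card X'(3) cp by (simp_all add: vs_def)
    moreover have "cp_decomp d A (vs X c)" "cp_decomp d A (vs X' c')"
      using cp_decomp_of_atomic_rep[OF AS d0 repd unit]
        cp_decomp_of_atomic_rep[OF AS d0 _ X'(2), of c'] X'(1) dd ydef by (simp_all add: vs_def)
    ultimately have "mset (vs X c) = mset (vs X' c')"
      using uniq unfolding unique_cp_rank_decomp_def by blast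
    moreover have "mset (vs Y e) = image_mset (\<lambda>x. node_vec d (e x) x) (mset_set Y)" for Y e
    proof -
      have "mset (sorted_list_of_set Y) = mset_set Y"
        by (metis sorted_list_of_mset_set mset_sorted_list_of_multiset)
      then show ?thesis by (simp add: vs_def)
    qed
    ultimately show "l = u"
      using moment_of_node_vecs[OF rep d0, of "2 * s + 1"] moment_of_node_vecs[OF X'(1) d0, of "2 * s + 1"]
        low[OF r] X'(4) by metis
  qed
  have iv1': "r \<le> s \<longrightarrow> unique_cp_rank_decomp d A" using iv1 by simp
  have iv2': "r = s + 1 \<longrightarrow> (unique_cp_rank_decomp d A \<longleftrightarrow> l = u)" using iv1 iv2 by blast
  show ?thesis
    by (intro conjI impI rs i1 i2 ii iii1 iii2 cp iv1'[rule_format] iv2'[rule_format])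
qed

end
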